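(* Let $X$ be a reflexive real or complex Banach space, and let $T$ be a power-bounded operator on $X$. If for some scalar $\alpha$ we have $T=\alpha I+S$, where $S$ is a bounded linear operator on $X$ such that $S^k$ is compact for some integer $k\ge 1$, then $T$ (on $X$) and its adjoint $T^*$ (on $X^*$) are almost periodic.
   Context: Operators are bounded linear operators from a Banach space to itself; $I$ is the identity and $X^*$ is the (continuous) dual of $X$. An operator $T$ is power-bounded if $\sup_{n\ge 0}\|T^n\|<\infty$. An operator $T$ on a Banach space $X$ is called almost periodic if for every $x\in X$ the orbit $\{T^n x\}_{n\ge 0}$ is conditionally compact, i.e. has compact closure in the norm topology. *)

theory Defs
  imports "HOL-Analysis.Analysis"
begin

text \<open>The scalar field is \<open>real\<close> or \<open>complex\<close>, up to isometric isomorphism.\<close>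

class real_or_complex = real_normed_field +
  assumes real_or_complex:
    "\<exists>\<phi> :: 'a \<Rightarrow> complex.
       (\<forall>a b. \<phi> (a + b) = \<phi> a + \<phi> b) \<and>
       (\<forall>a b. \<phi> (a * b) = \<phi> a * \<phi> b) \<and>
       (\<forall>r. \<phi> (scaleR r 1) = of_real r) \<and>
       (\<forall>a. cmod (\<phi> a) = norm a) \<and>
       (range \<phi> = \<real> \<or> range \<phi> = UNIV)"

instance real :: real_or_complex
proof
  show "\<exists>\<phi> :: real \<Rightarrow> complex.
       (\<forall>a b. \<phi> (a + b) = \<phi> a + \<phi> b) \<and>
       (\<forall>a b. \<phi> (a * b) = \<phi> a * \<phi> b) \<and>
       (\<forall>r. \<phi> (scaleR r 1) = of_real r) \<and>
       (\<forall>a. cmod (\<phi> a) = norm a) \<and>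
       (range \<phi> = \<real> \<or> range \<phi> = UNIV)"
    by (rule exI[of _ complex_of_real]) (auto simp: Reals_def)
qed

instance complex :: real_or_complex
proof
  show "\<exists>\<phi> :: complex \<Rightarrow> complex.
       (\<forall>a b. \<phi> (a + b) = \<phi> a + \<phi> b) \<and>
       (\<forall>a b. \<phi> (a * b) = \<phi> a * \<phi> b) \<and>
       (\<forall>r. \<phi> (scaleR r 1) = of_real r) \<and>
       (\<forall>a. cmod (\<phi> a) = norm a) \<and>
       (range \<phi> = \<real> \<or> range \<phi> = UNIV)"
    by (rule exI[of _ "\<lambda>z. z"]) (auto simp: scaleR_conv_of_real)
qed

text \<open>
  A Banach space over \<open>'k\<close>: the class \<open>banach\<close> supplies the norm, completeness and the real
  structure, and \<open>scal\<close> is a scalar multiplication by \<open>'k\<close> extending the real one.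
\<close>

locale banach_space_over = vector_space scal
  for scal :: "'k::real_or_complex \<Rightarrow> 'a::banach \<Rightarrow> 'a" +
  assumes scale_of_real: "scal (of_real r) x = r *\<^sub>R x"
    and norm_scale: "norm (scal c x) = norm c * norm x"

lemma banach_space_over_scaleR:
  "banach_space_over (scaleR :: real \<Rightarrow> 'a::banach \<Rightarrow> 'a)"
  by unfold_locales (auto simp: algebra_simps)

text \<open>The type \<open>'a \<Rightarrow>\<^sub>L 'a\<close> consists of the real-linear bounded operators.\<close>

definition scalar_linear :: "('k::real_or_complex \<Rightarrow> 'a::banach \<Rightarrow> 'a) \<Rightarrow> ('a \<Rightarrow>\<^sub>L 'a) \<Rightarrow> bool" where
  "scalar_linear scal T \<longleftrightarrow> (\<forall>c x. T (scal c x) = scal c (T x))"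

text \<open>
  The dual space is a norm-closed subset of \<open>'a \<Rightarrow>\<^sub>L 'k\<close>, whose norm is the operator norm.
\<close>

definition dual :: "('k::real_or_complex \<Rightarrow> 'a::banach \<Rightarrow> 'a) \<Rightarrow> ('a \<Rightarrow>\<^sub>L 'k) set" where
  "dual scal = {f. \<forall>c x. blinfun_apply f (scal c x) = c * blinfun_apply f x}"

definition dual_scale :: "'k::real_or_complex \<Rightarrow> ('a::banach \<Rightarrow>\<^sub>L 'k) \<Rightarrow> ('a \<Rightarrow>\<^sub>L 'k)" where
  "dual_scale c f = blinfun_mult_right c o\<^sub>L f"

lemma dual_scale_apply [simp]: "dual_scale c f x = c * f x"
  by (simp add: dual_scale_def)

lemma dual_scale_in_dual: "f \<in> dual scal \<Longrightarrow> dual_scale c f \<in> dual scal"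
  by (simp add: dual_def)

lemma add_in_dual: "f \<in> dual scal \<Longrightarrow> g \<in> dual scal \<Longrightarrow> f + g \<in> dual scal"
  by (simp add: dual_def blinfun.add_left distrib_left)

lemma closed_dual: "closed (dual scal)"
proof -
  have "dual scal = (\<Inter>c. \<Inter>x. {f. blinfun_apply f (scal c x) = c * blinfun_apply f x})"
    by (auto simp: dual_def)
  also have "closed \<dots>"
    by (intro closed_INT ballI closed_Collect_eq continuous_intros)
  finally show ?thesis .
qed

lemma dual_scaleR: "dual (scaleR :: real \<Rightarrow> 'a::banach \<Rightarrow> 'a) = UNIV"
  by (auto simp: dual_def blinfun.scaleR_right)

definition bidual ::
  "('k::real_or_complex \<Rightarrow> 'a::banach \<Rightarrow> 'a) \<Rightarrow> (('a \<Rightarrow>\<^sub>L 'k) \<Rightarrow> 'k) set" where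
  "bidual scal = {\<Phi>.
     (\<forall>f\<in>dual scal. \<forall>g\<in>dual scal. \<Phi> (f + g) = \<Phi> f + \<Phi> g) \<and>
     (\<forall>c. \<forall>f\<in>dual scal. \<Phi> (dual_scale c f) = c * \<Phi> f) \<and>
     (\<exists>K. \<forall>f\<in>dual scal. norm (\<Phi> f) \<le> K * norm f)}"

text \<open>
  Surjectivity of the canonical map into the bidual. Members of \<open>bidual scal\<close> are unconstrained
  outside \<open>dual scal\<close>, so they are compared on \<open>dual scal\<close> only.
\<close>

definition reflexive :: "('k::real_or_complex \<Rightarrow> 'a::banach \<Rightarrow> 'a) \<Rightarrow> bool" where
  "reflexive scal \<longleftrightarrow> (\<forall>\<Phi>\<in>bidual scal. \<exists>x. \<forall>f\<in>dual scal. \<Phi> f = blinfun_apply f x)"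

definition adjoint_op :: "('a::banach \<Rightarrow>\<^sub>L 'a) \<Rightarrow> ('a \<Rightarrow>\<^sub>L 'k::real_or_complex) \<Rightarrow> ('a \<Rightarrow>\<^sub>L 'k)" where
  "adjoint_op T f = f o\<^sub>L T"

lemma adjoint_op_in_dual:
  "scalar_linear scal T \<Longrightarrow> f \<in> dual scal \<Longrightarrow> adjoint_op T f \<in> dual scal"
  by (simp add: dual_def scalar_linear_def adjoint_op_def)

definition power_bounded :: "('a::banach \<Rightarrow>\<^sub>L 'a) \<Rightarrow> bool" where
  "power_bounded T \<longleftrightarrow> bdd_above (range (\<lambda>n. onorm (blinfun_apply T ^^ n)))"

definition compact_operator :: "('a::real_normed_vector \<Rightarrow> 'b::real_normed_vector) \<Rightarrow> bool" where
  "compact_operator f \<longleftrightarrow> (\<forall>B. bounded B \<longrightarrow> compact (closure (f ` B)))"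

text \<open>
  Almost periodicity of an operator on a closed invariant subspace \<open>V\<close>; since \<open>V\<close> is closed, the
  closure of an orbit in \<open>V\<close> is its closure in the whole type.
\<close>

definition almost_periodic_on :: "'b::real_normed_vector set \<Rightarrow> ('b \<Rightarrow> 'b) \<Rightarrow> bool" where
  "almost_periodic_on V T \<longleftrightarrow> (\<forall>x\<in>V. compact (closure (range (\<lambda>n. (T ^^ n) x))))"

end

theory Submission
  imports Defs
begin

text \<open>
  If \<open>norm \<alpha> \<noteq> 1\<close>, the orbits are relatively compact without reflexivity: \<open>S ^^ k\<close> maps an orbit
  to a relatively compact sequence, and if \<open>S u\<^sub>n = u\<^sub>n\<^sub>+\<^sub>1 - \<alpha> u\<^sub>n\<close> is relatively compact, then
  so is \<open>u\<close>, which brings \<open>k\<close> down to \<open>0\<close>.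

  If \<open>norm \<alpha> = 1\<close>, the mean ergodic theorem for \<open>T / \<alpha>\<close> says that \<open>ker S + ran S\<close> is dense, hence
  so is \<open>ker S + ran (S ^^ k)\<close>. Orbits in \<open>ker S\<close> are bounded sets of scalar multiples of one vector,
  and the orbit of \<open>(S ^^ k) y\<close> is the image under the compact operator \<open>S ^^ k\<close> of the bounded orbit
  of \<open>y\<close>. Vectors with relatively compact orbit form a closed set.

  The density is a Hahn--Banach argument that treats the space and its dual alike. By power
  boundedness \<open>norm u \<le> M * norm (u + S y)\<close> for \<open>u \<in> ker S\<close>, so every functional can be changed to one that
  agrees with it on \<open>ker S\<close> and vanishes on \<open>ran S\<close>; in the dual, reflexivity turns such
  functionals into vectors. The adjoint of \<open>S ^^ k\<close> is compact by Schauder's theorem.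
\<close>

section \<open>Scalars and the Hahn--Banach theorem\<close>

lemma real_or_complex_isometry:
  obtains \<phi> :: "'k::real_or_complex \<Rightarrow> complex"
  where "\<And>a b. \<phi> (a + b) = \<phi> a + \<phi> b" "\<And>a b. \<phi> (a * b) = \<phi> a * \<phi> b"
    "\<And>r. \<phi> (of_real r) = of_real r" "\<And>a. norm (\<phi> a) = norm a"
    "range \<phi> = \<real> \<or> range \<phi> = UNIV" "\<And>a b. \<phi> (a - b) = \<phi> a - \<phi> b" "inj \<phi>"
proof -
  obtain \<phi> :: "'k \<Rightarrow> complex" where \<phi>: "\<forall>a b. \<phi> (a + b) = \<phi> a + \<phi> b" "\<forall>a b. \<phi> (a * b) = \<phi> a * \<phi> b"
    "\<forall>r. \<phi> (r *\<^sub>R 1) = of_real r" "\<forall>a. norm (\<phi> a) = norm a" "range \<phi> = \<real> \<or> range \<phi> = UNIV"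
    using real_or_complex[where 'a='k] by blast
  have diff: "\<phi> (a - b) = \<phi> a - \<phi> b" for a b
    using \<phi>(1)[rule_format, of "a - b" b] by simp
  have "inj \<phi>"
  proof (rule injI)
    fix a b assume "\<phi> a = \<phi> b"
    then have "norm (a - b) = 0" using \<phi>(4)[rule_format, of "a - b"] diff by simp
    then show "a = b" by simp
  qed
  then show thesis
    using that[of \<phi>] \<phi> diff by (simp add: of_real_def)
qed

text \<open>A bounded sequence of scalars has a subsequence converging in the complex plane, and the
  embedded field is closed there, so the isometry carries the limit back. This makes bounded sets of
  scalars precompact.\<close>

instance real_or_complex \<subseteq> heine_borel
proof
  fix f :: "nat \<Rightarrow> 'a"
  assume "bounded (range f)"
  obtain \<phi> :: "'a \<Rightarrow> complex" where \<phi>: "\<And>a. norm (\<phi> a) = norm a"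
    "range \<phi> = \<real> \<or> range \<phi> = UNIV" "\<And>a b. \<phi> (a - b) = \<phi> a - \<phi> b"
    by (rule real_or_complex_isometry) blast
  from \<open>bounded (range f)\<close> have "bounded (range (\<phi> \<circ> f))"
    by (auto simp: bounded_iff \<phi>)
  then obtain l r where lr: "strict_mono (r :: nat \<Rightarrow> nat)" "(\<phi> \<circ> f \<circ> r) \<longlonglongrightarrow> l"
    using bounded_imp_convergent_subsequence by blast
  have "closed (range \<phi>)"
    using \<phi>(2) closed_complex_Reals by auto
  then have "l \<in> range \<phi>"
    by (rule closed_sequentially[OF _ _ lr(2)]) auto
  then obtain m where m: "l = \<phi> m" by auto
  have "(f \<circ> r) \<longlonglongrightarrow> m"
    using lr(2) unfolding m LIMSEQ_iff comp_def \<phi>(3)[symmetric] \<phi>(1) .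
  with lr(1) show "\<exists>l r. strict_mono (r :: nat \<Rightarrow> nat) \<and> ((f \<circ> r) \<longlongrightarrow> l) sequentially"
    by blast
qed

instance real_or_complex \<subseteq> banach ..

text \<open>In the complex case z = Re z - i Re(i z), so a scalar functional is determined by its
  real part. This reduces Hahn--Banach over either field to the real one.\<close>

lemma real_part_decomposition:
  obtains (real) \<rho> :: "'k::real_or_complex \<Rightarrow> real"
  where "linear \<rho>" "\<And>z. \<bar>\<rho> z\<bar> \<le> norm z" "\<And>z. z = of_real (\<rho> z)"
  | (complex) \<rho> :: "'k::real_or_complex \<Rightarrow> real" and \<i>' :: "'k::real_or_complex"
  where "linear \<rho>" "\<And>z. \<bar>\<rho> z\<bar> \<le> norm z" "\<i>' * \<i>' = -1" "norm \<i>' = 1"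
    "\<And>z. z = of_real (\<rho> z) - \<i>' * of_real (\<rho> (\<i>' * z))"
proof -
  obtain \<phi> :: "'k \<Rightarrow> complex" where \<phi>: "\<And>a b. \<phi> (a + b) = \<phi> a + \<phi> b"
    "\<And>a b. \<phi> (a * b) = \<phi> a * \<phi> b" "\<And>r. \<phi> (of_real r) = of_real r" "\<And>a. norm (\<phi> a) = norm a"
    "range \<phi> = \<real> \<or> range \<phi> = UNIV" "\<And>a b. \<phi> (a - b) = \<phi> a - \<phi> b" "inj \<phi>"
    by (rule real_or_complex_isometry) blast
  let ?\<rho> = "\<lambda>z. Re (\<phi> z)"
  have lin: "linear ?\<rho>"
    by (rule linearI) (simp_all add: \<phi> scaleR_conv_of_real)
  have bound: "\<bar>?\<rho> z\<bar> \<le> norm z" for z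
    using abs_Re_le_cmod[of "\<phi> z"] by (simp add: \<phi>)
  from \<phi>(5) show thesis
  proof
    assume range: "range \<phi> = \<real>"
    have "z = of_real (?\<rho> z)" for z
    proof (rule injD[OF \<phi>(7)])
      have "\<phi> z \<in> \<real>" using range by blast
      then show "\<phi> z = \<phi> (of_real (?\<rho> z))" by (simp add: \<phi>)
    qed
    with lin bound show thesis by (rule real)
  next
    assume "range \<phi> = UNIV"
    then obtain j where j: "\<phi> j = \<i>" by (metis rangeE UNIV_I)
    have 1: "j * j = -1"
    proof (rule injD[OF \<phi>(7)])
      have "\<phi> (-1) = -1" using \<phi>(3)[of "-1"] by simp
      then show "\<phi> (j * j) = \<phi> (-1)" by (simp add: \<phi> j)
    qed
    have 2: "norm j = 1" using \<phi>(4)[of j] j by simp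
    have 3: "z = of_real (?\<rho> z) - j * of_real (?\<rho> (j * z))" for z
      by (rule injD[OF \<phi>(7)]) (simp add: \<phi> j complex_eq_iff)
    from lin bound 1 2 3 show thesis by (rule complex)
  qed
qed

section \<open>The real Hahn--Banach theorem\<close>

text \<open>A value \<open>a\<close> at \<open>z\<close> keeps the bound if it lies between all
  \<open>r - C * norm (x - z)\<close> and all \<open>C * norm (y + z) - t\<close>. The triangle
  inequality puts each of the former below each of the latter, so the supremum of the former will
  do.\<close>

lemma hahn_banach_real_step:
  fixes G :: "('a::real_normed_vector \<times> real) set"
  assumes G: "subspace G" and bound: "\<And>x r. (x, r) \<in> G \<Longrightarrow> r \<le> C * norm x" and "C \<ge> 0"
  obtains H a where "subspace H" "G \<subseteq> H" "(z, a) \<in> H"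
    "\<And>x r. (x, r) \<in> H \<Longrightarrow> r \<le> C * norm x"
proof -
  have sep: "r - C * norm (x - z) \<le> C * norm (y + z) - t" if "(x, r) \<in> G" "(y, t) \<in> G" for x r y t
  proof -
    have "r + t \<le> C * norm (x + y)"
      using bound subspace_add[OF G that] by simp
    also have "\<dots> \<le> C * (norm (x - z) + norm (y + z))"
      using norm_triangle_ineq[of "x - z" "y + z"] \<open>C \<ge> 0\<close> by (intro mult_left_mono) auto
    finally show ?thesis by (simp add: algebra_simps)
  qed
  have 0: "(0, 0) \<in> G" using subspace_0[OF G] by (simp add: zero_prod_def)
  define L where "L = (\<lambda>(x, r). r - C * norm (x - z)) ` G"
  define a where "a = Sup L"
  have bdd: "bdd_above L"
    unfolding L_def by (rule bdd_aboveI2[of _ _ "C * norm z"]) (use sep 0 in fastforce)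
  have lower: "r - C * norm (x - z) \<le> a" if "(x, r) \<in> G" for x r
    unfolding a_def by (rule cSup_upper[OF _ bdd]) (use that in \<open>force simp: L_def\<close>)
  have upper: "a \<le> C * norm (y + z) - t" if "(y, t) \<in> G" for y t
    unfolding a_def L_def by (rule cSup_least) (use that sep 0 in auto)
  define H where "H = {g + h | g h. g \<in> G \<and> h \<in> span {(z, a)}}"
  have "subspace H"
    unfolding H_def by (rule subspace_sums[OF G subspace_span])
  moreover have "G \<subseteq> H"
  proof
    fix g assume "g \<in> G"
    moreover have "g = g + 0" by simp
    ultimately show "g \<in> H" unfolding H_def using span_zero by blast
  qed
  moreover have "(z, a) \<in> H"
  proof -
    have "(z, a) = (0, 0) + (z, a)" by simp
    then show ?thesis unfolding H_def using 0 span_base by blast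
  qed
  moreover have "r \<le> C * norm x" if xr: "(x, r) \<in> H" for x r
  proof -
    obtain y t c where y: "(y, t) \<in> G" "x = y + c *\<^sub>R z" "r = t + c * a"
      using xr by (auto simp: H_def span_singleton)
    have scaled: "(d *\<^sub>R y, d * t) \<in> G" for d
      using subspace_scale[OF G y(1), of d] by simp
    \<comment> \<open>Dividing by the absolute value of \<open>c\<close> leaves a vector of the
      graph's domain plus or minus \<open>z\<close>, which is the situation governed by
      \<open>upper\<close> or \<open>lower\<close>.\<close>
    consider "c = 0" | "c > 0" | "c < 0" by linarith
    then show ?thesis
    proof cases
      case 1
      then show ?thesis using y bound by simp
    next
      case 2
      have "a \<le> C * norm ((1/c) *\<^sub>R y + z) - (1/c) * t"
        by (rule upper[OF scaled])
      then have "c * a \<le> c * (C * norm ((1/c) *\<^sub>R y + z) - (1/c) * t)"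
        using 2 by (intro mult_left_mono) auto
      also have "\<dots> = C * norm (c *\<^sub>R ((1/c) *\<^sub>R y + z)) - t"
        unfolding norm_scaleR using 2 by (simp add: algebra_simps)
      also have "c *\<^sub>R ((1/c) *\<^sub>R y + z) = x"
        using 2 y by (simp add: algebra_simps)
      finally show ?thesis using y by simp
    next
      case 3
      have "(-1/c) * t - C * norm ((-1/c) *\<^sub>R y - z) \<le> a"
        by (rule lower[OF scaled])
      then have "(-c) * ((-1/c) * t - C * norm ((-1/c) *\<^sub>R y - z)) \<le> (-c) * a"
        using 3 by (intro mult_left_mono) auto
      moreover have "(-c) * ((-1/c) * t - C * norm ((-1/c) *\<^sub>R y - z))
          = t - C * norm ((-c) *\<^sub>R ((-1/c) *\<^sub>R y - z))"
        unfolding norm_scaleR using 3 by (simp add: algebra_simps)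
      moreover have "(-c) *\<^sub>R ((-1/c) *\<^sub>R y - z) = x"
        using 3 y by (simp add: algebra_simps)
      ultimately have "t - C * norm x \<le> (-c) * a" by metis
      then show ?thesis using y by simp
    qed
  qed
  ultimately show thesis using that by blast
qed

text \<open>
  Functionals are given by their graphs; the bound on a graph that is a subspace already forces
  it to be single-valued.
\<close>

theorem hahn_banach_real:
  fixes G :: "('a::real_normed_vector \<times> real) set"
  assumes G: "subspace G" and bound: "\<And>x r. (x, r) \<in> G \<Longrightarrow> r \<le> C * norm x" and "C \<ge> 0"
  obtains g where "linear g" "\<And>x. \<bar>g x\<bar> \<le> C * norm x" "\<And>x r. (x, r) \<in> G \<Longrightarrow> g x = r"
proof -
  define \<A> where "\<A> = {H. subspace H \<and> G \<subseteq> H \<and> (\<forall>(x, r)\<in>H. r \<le> C * norm x)}"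
  have "\<exists>M\<in>\<A>. \<forall>X\<in>\<A>. M \<subseteq> X \<longrightarrow> X = M"
  proof (rule subset_Zorn_nonempty)
    show "\<A> \<noteq> {}" using G bound by (auto simp: \<A>_def)
  next
    fix \<C> assume "\<C> \<noteq> {}" and chain: "subset.chain \<A> \<C>"
    then have "\<C> \<subseteq> \<A>" by (simp add: subset.chain_def)
    then have \<C>: "subspace H" "G \<subseteq> H" "\<And>x r. (x, r) \<in> H \<Longrightarrow> r \<le> C * norm x" if "H \<in> \<C>" for H
      using that by (auto simp: \<A>_def)
    have "subspace (\<Union>\<C>)"
    proof (rule real_vector.subspaceI)
      show "0 \<in> \<Union>\<C>" using \<open>\<C> \<noteq> {}\<close> \<C>(1) subspace_0 by blast
    next
      fix x y assume "x \<in> \<Union>\<C>" "y \<in> \<Union>\<C>"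
      then obtain A B where AB: "A \<in> \<C>" "x \<in> A" "B \<in> \<C>" "y \<in> B" by blast
      then have "A \<subseteq> B \<or> B \<subseteq> A" using chain by (auto simp: subset_chain_def)
      then obtain D where "D \<in> \<C>" "x \<in> D" "y \<in> D" using AB by blast
      then show "x + y \<in> \<Union>\<C>" using \<C>(1) subspace_add by blast
    next
      fix c x assume "x \<in> \<Union>\<C>"
      then show "c *\<^sub>R x \<in> \<Union>\<C>" using \<C>(1) subspace_scale by blast
    qed
    moreover have "G \<subseteq> \<Union>\<C>" using \<open>\<C> \<noteq> {}\<close> \<C>(2) by blast
    ultimately show "\<Union>\<C> \<in> \<A>" using \<C>(3) by (auto simp: \<A>_def)
  qed
  then obtain M where M: "M \<in> \<A>" and max: "\<And>X. X \<in> \<A> \<Longrightarrow> M \<subseteq> X \<Longrightarrow> X = M" by blast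
  from M have sub: "subspace M" and "G \<subseteq> M" and Mb: "\<And>x r. (x, r) \<in> M \<Longrightarrow> r \<le> C * norm x"
    by (auto simp: \<A>_def)
  have total: "\<exists>a. (z, a) \<in> M" for z
  proof -
    obtain H a where H: "subspace H" "M \<subseteq> H" "(z, a) \<in> H" "\<And>x r. (x, r) \<in> H \<Longrightarrow> r \<le> C * norm x"
      using hahn_banach_real_step[OF sub Mb \<open>C \<ge> 0\<close>] by blast
    then have "H \<in> \<A>" using \<open>G \<subseteq> M\<close> by (auto simp: \<A>_def)
    then have "H = M" using max H(2) by blast
    then show ?thesis using H(3) by blast
  qed
  have unique: "r = t" if "(x, r) \<in> M" "(x, t) \<in> M" for x r t
    using Mb[of 0 "r - t"] Mb[of 0 "t - r"] subspace_diff[OF sub that] subspace_diff[OF sub that(2,1)]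
    by simp
  define g where "g x = (THE a. (x, a) \<in> M)" for x
  have g: "(x, g x) \<in> M" for x
    unfolding g_def by (rule theI') (use total unique in blast)
  have eq: "g x = r" if "(x, r) \<in> M" for x r
    using g that unique by blast
  have lin: "linear g"
  proof (rule linearI)
    show "g (x + y) = g x + g y" for x y
      by (rule eq) (use subspace_add[OF sub g g] in simp)
    show "g (c *\<^sub>R x) = c *\<^sub>R g x" for c x
      by (rule eq) (use subspace_scale[OF sub g] in simp)
  qed
  \<comment> \<open>The one-sided bound at \<open>x\<close> and at \<open>-x\<close> gives the
    two-sided one.\<close>
  have "\<bar>g x\<bar> \<le> C * norm x" for x
    using Mb[OF g, of x] Mb[OF g, of "-x"] by (simp add: linear_neg[OF lin])
  with lin eq \<open>G \<subseteq> M\<close> show thesis by (intro that) auto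
qed

section \<open>Hahn--Banach over the scalar field, and separation from subspaces\<close>

context banach_space_over
begin

text \<open>The real parts of the values are extended over the reals, and a scalar functional is
  rebuilt from the extension. The conclusion claims only boundedness, so losing a factor 2 in the
  complex case does no harm.\<close>

theorem hahn_banach:
  fixes G :: "('a \<times> 'k) set"
  assumes "(0, 0) \<in> G"
    and add: "\<And>x r y t. (x, r) \<in> G \<Longrightarrow> (y, t) \<in> G \<Longrightarrow> (x + y, r + t) \<in> G"
    and mult: "\<And>c x r. (x, r) \<in> G \<Longrightarrow> (scal c x, c * r) \<in> G"
    and bound: "\<And>x r. (x, r) \<in> G \<Longrightarrow> norm r \<le> C * norm x" and "C \<ge> 0"
  obtains F where "F \<in> dual scal" "\<And>x r. (x, r) \<in> G \<Longrightarrow> blinfun_apply F x = r"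
proof -
  have ext: "\<exists>g. linear g \<and> (\<forall>x. \<bar>g x\<bar> \<le> C * norm x) \<and> (\<forall>x r. (x, r) \<in> G \<longrightarrow> g x = \<rho> r)"
    if \<rho>: "linear \<rho>" "\<And>z. \<bar>\<rho> z\<bar> \<le> norm z" for \<rho> :: "'k \<Rightarrow> real"
  proof -
    let ?G = "(\<lambda>(x, r). (x, \<rho> r)) ` G"
    have "real_vector.subspace ?G"
    proof (rule real_vector.subspaceI)
      show "0 \<in> ?G"
        using assms(1) linear_0[OF \<rho>(1)] by (force simp: zero_prod_def)
      show "p + q \<in> ?G" if "p \<in> ?G" "q \<in> ?G" for p q
        using that add by (force simp: linear_add[OF \<rho>(1), symmetric])
      show "c *\<^sub>R p \<in> ?G" if "p \<in> ?G" for c p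
      proof -
        from that obtain x r where xr: "(x, r) \<in> G" "p = (x, \<rho> r)" by auto
        have "(scal (of_real c) x, of_real c * r) \<in> G" by (rule mult[OF xr(1)])
        moreover have "c *\<^sub>R p = (\<lambda>(x, r). (x, \<rho> r)) (scal (of_real c) x, of_real c * r)"
          using xr(2) by (simp add: scale_of_real linear_scale[OF \<rho>(1)] flip: scaleR_conv_of_real)
        ultimately show ?thesis by (metis imageI)
      qed
    qed
    moreover have "r \<le> C * norm x" if "(x, r) \<in> ?G" for x r
    proof -
      from that obtain t where "(x, t) \<in> G" "r = \<rho> t" by auto
      then show ?thesis using bound[of x t] \<rho>(2)[of t] by linarith
    qed
    ultimately obtain g where "linear g" "\<And>x. \<bar>g x\<bar> \<le> C * norm x" "\<And>x r. (x, r) \<in> ?G \<Longrightarrow> g x = r"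
      using hahn_banach_real \<open>C \<ge> 0\<close> by blast
    then show ?thesis by (intro exI[of _ g]) force
  qed
  show thesis
  proof (cases rule: real_part_decomposition[where 'k='k])
    case (real \<rho>)
    then obtain g where g: "linear g" "\<And>x. \<bar>g x\<bar> \<le> C * norm x" "\<And>x r. (x, r) \<in> G \<Longrightarrow> g x = \<rho> r"
      using ext[of \<rho>] by blast
    have bl: "bounded_linear (\<lambda>x. of_real (g x) :: 'k)"
      by (rule bounded_linear_intro[of _ C])
        (use g(2) in \<open>auto simp: linear_add[OF g(1)] linear_scale[OF g(1)] scaleR_conv_of_real mult.commute\<close>)
    show thesis
    proof (rule that[of "Blinfun (\<lambda>x. of_real (g x))"])
      show "blinfun_apply (Blinfun (\<lambda>x. of_real (g x))) x = r" if "(x, r) \<in> G" for x r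
        using that g(3) real(3)[of r] by (simp add: bounded_linear_Blinfun_apply[OF bl])
      have "of_real (g (scal c x)) = c * of_real (g x)" for c x
      proof -
        have "of_real (g (scal c x)) = (of_real (g (\<rho> c *\<^sub>R x)) :: 'k)"
          using scale_of_real[of "\<rho> c" x] real(3)[of c] by simp
        also have "\<dots> = of_real (\<rho> c) * of_real (g x)"
          by (simp add: linear_scale[OF g(1)])
        finally show ?thesis using real(3)[of c] by simp
      qed
      then show "Blinfun (\<lambda>x. of_real (g x)) \<in> dual scal"
        by (simp add: dual_def bounded_linear_Blinfun_apply[OF bl])
    qed
  next
    case (complex \<rho> j)
    then obtain g where g: "linear g" "\<And>x. \<bar>g x\<bar> \<le> C * norm x" "\<And>x r. (x, r) \<in> G \<Longrightarrow> g x = \<rho> r"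
      using ext[of \<rho>] by blast
    \<comment> \<open>The formula z = Re z - i Re(i z), with \<open>g\<close> as the real part of
      \<open>f\<close>.\<close>
    define f :: "'a \<Rightarrow> 'k" where "f x = of_real (g x) - j * of_real (g (scal j x))" for x
    have f_add: "f (x + y) = f x + f y" for x y
      by (simp add: f_def scale_right_distrib linear_add[OF g(1)] algebra_simps)
    have f_real: "f (scal (of_real r) x) = of_real r * f x" for r x
    proof -
      have "scal j (scal (of_real r) x) = r *\<^sub>R scal j x"
        by (metis scale_of_real scale_left_commute)
      then show ?thesis
        by (simp add: f_def scale_of_real linear_scale[OF g(1)] algebra_simps)
    qed
    have f_j: "f (scal j x) = j * f x" for x
    proof -
      have "scal j (scal j x) = - x"
        using complex(3) by (simp add: scale_minus_left)
      then show ?thesis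
        using complex(3)
        by (simp add: f_def linear_neg[OF g(1)] algebra_simps flip: mult.assoc)
    qed
    have f_scal: "f (scal c x) = c * f x" for c x
    proof -
      \<comment> \<open>The same formula writes \<open>c\<close> as \<open>a + b * j\<close>, so
        homogeneity for real scalars and for \<open>j\<close> is enough.\<close>
      define a b where "a = \<rho> c" and "b = - \<rho> (j * c)"
      have c: "c = of_real a + of_real b * j"
        using complex(5)[of c] by (simp add: a_def b_def mult.commute)
      have "scal c x = scal (of_real a) x + scal (of_real b) (scal j x)"
        by (simp add: c scale_left_distrib)
      then have "f (scal c x) = of_real a * f x + of_real b * (j * f x)"
        by (simp only: f_add f_real f_j)
      also have "\<dots> = c * f x"
        by (subst c) (simp only: distrib_right mult.assoc)
      finally show ?thesis .
    qed
    have bl: "bounded_linear f"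
    proof (rule bounded_linear_intro[of _ "2 * C"])
      show "f (r *\<^sub>R x) = r *\<^sub>R f x" for r x
        using f_real[of r x] by (simp add: scale_of_real scaleR_conv_of_real)
      show "norm (f x) \<le> norm x * (2 * C)" for x
      proof -
        have "norm (f x) \<le> \<bar>g x\<bar> + \<bar>g (scal j x)\<bar>"
          unfolding f_def
          by (rule order_trans[OF norm_triangle_ineq4]) (simp add: norm_mult complex(4))
        also have "\<dots> \<le> norm x * (2 * C)"
          using g(2)[of x] g(2)[of "scal j x"] by (simp add: norm_scale complex(4) algebra_simps)
        finally show ?thesis .
      qed
    qed (rule f_add)
    show thesis
    proof (rule that[of "Blinfun f"])
      show "Blinfun f \<in> dual scal"
        by (simp add: dual_def bounded_linear_Blinfun_apply[OF bl] f_scal)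
      show "blinfun_apply (Blinfun f) x = r" if "(x, r) \<in> G" for x r
        using g(3)[OF that] g(3)[OF mult[OF that, of j]] complex(5)[of r]
        by (simp add: bounded_linear_Blinfun_apply[OF bl] f_def)
    qed
  qed
qed

text \<open>If \<open>x\<close> has distance at least \<open>d > 0\<close> from \<open>W\<close>,
  then sending \<open>w + scal c x\<close> to \<open>c\<close> is bounded by \<open>1 / d\<close>
  and extends by Hahn--Banach.\<close>

theorem hahn_banach_separation:
  assumes W: "subspace W" and x: "x \<notin> closure W"
  obtains F where "F \<in> dual scal" "\<And>w. w \<in> W \<Longrightarrow> blinfun_apply F w = 0" "blinfun_apply F x \<noteq> 0"
proof -
  from x obtain d where d: "d > 0" "\<And>w. w \<in> W \<Longrightarrow> d \<le> norm (x - w)"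
    by (metis closure_approachable dist_norm norm_minus_commute not_less)
  define G where "G = {(w + scal c x, c) | w c. w \<in> W}"
  show thesis
  proof (rule hahn_banach[of G "1 / d"])
    show "(0, 0) \<in> G"
      unfolding G_def using subspace_0[OF W] by force
    show "(y + z, r + t) \<in> G" if "(y, r) \<in> G" "(z, t) \<in> G" for y z r t
    proof -
      obtain v w where "v \<in> W" "w \<in> W" "y = v + scal r x" "z = w + scal t x"
        using \<open>(y, r) \<in> G\<close> \<open>(z, t) \<in> G\<close> by (auto simp: G_def)
      then have "v + w \<in> W" "y + z = (v + w) + scal (r + t) x"
        by (auto simp: subspace_add[OF W] scale_left_distrib algebra_simps)
      then show ?thesis unfolding G_def by blast
    qed
    show "(scal c y, c * r) \<in> G" if "(y, r) \<in> G" for c y r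
    proof -
      from that obtain v where "v \<in> W" "y = v + scal r x"
        by (auto simp: G_def)
      then have "scal c v \<in> W" "scal c y = scal c v + scal (c * r) x"
        by (auto simp: subspace_scale[OF W] scale_right_distrib)
      then show ?thesis unfolding G_def by blast
    qed
    show "norm r \<le> 1 / d * norm y" if yr: "(y, r) \<in> G" for y r
    proof (cases "r = 0")
      case False
      obtain v where v: "v \<in> W" "y = v + scal r x" using yr by (auto simp: G_def)
      \<comment> \<open>Here \<open>y\<close> is \<open>r\<close> times the difference of
        \<open>x\<close> and the element \<open>- v / r\<close> of \<open>W\<close>.\<close>
      have "d \<le> norm (x - scal (- inverse r) v)"
        by (rule d(2)[OF subspace_scale[OF W v(1)]])
      then have "norm r * d \<le> norm r * norm (x - scal (- inverse r) v)"
        by (rule mult_left_mono) simp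
      also have "\<dots> = norm y"
        using False v(2)
        by (simp add: norm_scale[symmetric] scale_right_distrib scale_right_diff_distrib
            scale_minus_left add.commute)
      finally show ?thesis using d(1) by (simp add: field_simps)
    qed (use d(1) in simp)
  next
    fix F assume F: "F \<in> dual scal" "\<And>y r. (y, r) \<in> G \<Longrightarrow> blinfun_apply F y = r"
    show thesis
    proof (rule that[OF F(1)])
      show "blinfun_apply F w = 0" if "w \<in> W" for w
        by (rule F(2)) (use that in \<open>force simp: G_def\<close>)
      have "blinfun_apply F x = 1"
        by (rule F(2)) (use subspace_0[OF W] in \<open>force simp: G_def\<close>)
      then show "blinfun_apply F x \<noteq> 0" by simp
    qed
  qed (use d(1) in simp)
qed

corollary dual_separates_points:
  assumes "\<And>f. f \<in> dual scal \<Longrightarrow> blinfun_apply f x = 0"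
  shows "x = 0"
proof (rule ccontr)
  assume "x \<noteq> 0"
  then have "x \<notin> closure {0}" by simp
  then show False
    using hahn_banach_separation[OF subspace_single_0] assms by metis
qed

end

section \<open>Precompact sets and compact adjoints\<close>

text \<open>Total boundedness, with centres allowed anywhere in the space. In a complete space it
  amounts to compact closure, and finite nets are easy to build and to combine.\<close>

definition precompact :: "'a::metric_space set \<Rightarrow> bool" where
  "precompact A \<longleftrightarrow> (\<forall>e>0. \<exists>F. finite F \<and> A \<subseteq> (\<Union>x\<in>F. ball x e))"

lemma precompactE:
  assumes "precompact A" "e > 0"
  obtains F where "finite F" "\<forall>x\<in>A. \<exists>y\<in>F. dist y x < e"
proof -
  obtain F where "finite F" "A \<subseteq> (\<Union>x\<in>F. ball x e)"
    using assms unfolding precompact_def by blast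
  then show thesis by (intro that[of F]) (simp_all add: subset_eq)
qed

lemma precompactI:
  assumes "\<And>e. e > 0 \<Longrightarrow> \<exists>F. finite F \<and> (\<forall>x\<in>A. \<exists>y\<in>F. dist y x < e)"
  shows "precompact A"
  unfolding precompact_def
proof (intro allI impI)
  fix e :: real assume "e > 0"
  then obtain F where "finite F" "\<forall>x\<in>A. \<exists>y\<in>F. dist y x < e" using assms by blast
  then show "\<exists>F. finite F \<and> A \<subseteq> (\<Union>x\<in>F. ball x e)" by (intro exI[of _ F]) auto
qed

lemma precompact_subset: "precompact B \<Longrightarrow> A \<subseteq> B \<Longrightarrow> precompact A"
  by (rule precompactI, erule (1) precompactE) blast

lemma precompact_of_compact_closure:
  assumes "compact (closure A)"
  shows "precompact A"
proof -
  have "precompact (closure A)"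
    using assms by (simp add: compact_eq_totally_bounded precompact_def)
  then show ?thesis by (rule precompact_subset[OF _ closure_subset])
qed

text \<open>Two errors of \<open>e / 2\<close> add up. This carries precompactness over to closures
  and, later, from the orbits of a dense set of vectors to all orbits.\<close>

lemma precompact_approx:
  assumes "\<And>e. e > 0 \<Longrightarrow> \<exists>B. precompact B \<and> (\<forall>x\<in>A. \<exists>y\<in>B. dist y x < e)"
  shows "precompact A"
proof (rule precompactI)
  fix e :: real assume "e > 0"
  then obtain B where B: "precompact B" "\<forall>x\<in>A. \<exists>y\<in>B. dist y x < e / 2"
    using assms[of "e / 2"] by auto
  have e2: "e / 2 > 0" using \<open>e > 0\<close> by simp
  obtain F where F: "finite F" "\<forall>x\<in>B. \<exists>y\<in>F. dist y x < e / 2"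
    by (rule precompactE[OF B(1) e2])
  have "\<exists>y\<in>F. dist y x < e" if x: "x \<in> A" for x
  proof -
    obtain y where y: "y \<in> B" "dist y x < e / 2" using B(2) x by blast
    obtain z where z: "z \<in> F" "dist z y < e / 2" using F(2) y(1) by blast
    have "dist z x < e" using dist_triangle[of z x y] y z by linarith
    then show ?thesis using z(1) by blast
  qed
  then show "\<exists>F. finite F \<and> (\<forall>x\<in>A. \<exists>y\<in>F. dist y x < e)" using F(1) by blast
qed

lemma compact_closure_of_precompact:
  fixes A :: "'a::complete_space set"
  assumes "precompact A"
  shows "compact (closure A)"
proof -
  have "precompact (closure A)"
  proof (rule precompact_approx)
    fix e :: real assume "e > 0"
    then have "\<forall>x\<in>closure A. \<exists>y\<in>A. dist y x < e"
      by (simp add: closure_approachable)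
    with assms show "\<exists>B. precompact B \<and> (\<forall>x\<in>closure A. \<exists>y\<in>B. dist y x < e)" by blast
  qed
  then show ?thesis
    by (simp add: compact_eq_totally_bounded complete_eq_closed precompact_def)
qed

lemma precompact_sums:
  fixes A B :: "'a::real_normed_vector set"
  assumes "precompact A" "precompact B"
  shows "precompact {x + y | x y. x \<in> A \<and> y \<in> B}"
proof (rule precompactI)
  fix e :: real assume "e > 0"
  then have e2: "e / 2 > 0" by simp
  obtain F where F: "finite F" "\<forall>x\<in>A. \<exists>y\<in>F. dist y x < e / 2"
    by (rule precompactE[OF assms(1) e2])
  obtain G where G: "finite G" "\<forall>x\<in>B. \<exists>y\<in>G. dist y x < e / 2"
    by (rule precompactE[OF assms(2) e2])
  have "\<exists>z\<in>(\<lambda>(f, g). f + g) ` (F \<times> G). dist z (x + y) < e" if xy: "x \<in> A" "y \<in> B" for x y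
  proof -
    obtain f where f: "f \<in> F" "dist f x < e / 2" using F(2) xy(1) by blast
    obtain g where g: "g \<in> G" "dist g y < e / 2" using G(2) xy(2) by blast
    have "dist (f + g) (x + y) < e"
      using dist_triangle_add[of f g x y] f g by linarith
    then show ?thesis using f(1) g(1) by force
  qed
  then show "\<exists>H. finite H \<and> (\<forall>z\<in>{x + y | x y. x \<in> A \<and> y \<in> B}. \<exists>y\<in>H. dist y z < e)"
    using F(1) G(1) by (intro exI[of _ "(\<lambda>(f, g). f + g) ` (F \<times> G)"]) auto
qed

section \<open>Adjoints and Schauder's theorem\<close>

lemma adjoint_op_apply [simp]: "blinfun_apply (adjoint_op T f) x = blinfun_apply f (blinfun_apply T x)"
  by (simp add: adjoint_op_def)

lemma adjoint_op_power_apply: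
  "blinfun_apply ((adjoint_op T ^^ n) f) x = blinfun_apply f ((blinfun_apply T ^^ n) x)"
proof (induction n arbitrary: f)
  case (Suc n)
  have "(adjoint_op T ^^ Suc n) f = (adjoint_op T ^^ n) (adjoint_op T f)"
    by (simp only: funpow_Suc_right o_apply)
  then show ?case by (simp only: Suc adjoint_op_apply funpow.simps(2) o_apply)
qed simp

lemma bounded_linear_adjoint_op:
  "bounded_linear (adjoint_op T :: ('a::banach \<Rightarrow>\<^sub>L 'k::real_or_complex) \<Rightarrow> _)"
  unfolding adjoint_op_def by (rule bounded_bilinear.bounded_linear_left[OF bounded_bilinear_blinfun_compose])

text \<open>The values of \<open>B\<close> at one point form a bounded, hence precompact, set of
  scalars. Labelling \<open>f\<close> by a \<open>d / 2\<close>-close net point for every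
  \<open>c\<close> in \<open>C\<close> gives finitely many labels, and functionals with equal labels
  are \<open>d\<close>-close on \<open>C\<close>. The net lies in \<open>B\<close> so that it
  inherits the norm bound of \<open>B\<close>.\<close>

lemma finite_net_bounded_functionals:
  fixes B :: "('a::banach \<Rightarrow>\<^sub>L 'k::real_or_complex) set"
  assumes "bounded B" "finite C" "d > 0"
  obtains F where "finite F" "F \<subseteq> B"
    "\<And>f. f \<in> B \<Longrightarrow> \<exists>g\<in>F. \<forall>c\<in>C. norm (blinfun_apply g c - blinfun_apply f c) < d"
proof -
  have "\<exists>N. finite N \<and> (\<forall>f\<in>B. \<exists>y\<in>N. dist y (blinfun_apply f c) < d / 2)" for c
  proof -
    obtain M where M: "\<And>f. f \<in> B \<Longrightarrow> norm f \<le> M" using \<open>bounded B\<close> by (auto simp: bounded_iff)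
    have "norm (blinfun_apply f c) \<le> M * norm c" if "f \<in> B" for f
      by (rule order_trans[OF norm_blinfun mult_right_mono[OF M[OF that]]]) simp
    then have "bounded ((\<lambda>f. blinfun_apply f c) ` B)" by (auto simp: bounded_iff)
    then have "compact (closure ((\<lambda>f. blinfun_apply f c) ` B))"
      by (simp add: compact_closure)
    then have pre: "precompact ((\<lambda>f. blinfun_apply f c) ` B)"
      by (rule precompact_of_compact_closure)
    have "d / 2 > 0" using \<open>d > 0\<close> by simp
    with pre obtain N where "finite N" "\<forall>y\<in>(\<lambda>f. blinfun_apply f c) ` B. \<exists>z\<in>N. dist z y < d / 2"
      by (rule precompactE)
    then show ?thesis by blast
  qed
  then obtain N where N: "\<And>c. finite (N c)"
    "\<And>c f. f \<in> B \<Longrightarrow> \<exists>y\<in>N c. dist y (blinfun_apply f c) < d / 2" by metis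
  define p where "p f c = (SOME y. y \<in> N c \<and> dist y (blinfun_apply f c) < d / 2)" for f c
  have p: "p f c \<in> N c" "dist (p f c) (blinfun_apply f c) < d / 2" if "f \<in> B" for f c
    using someI_ex[of "\<lambda>y. y \<in> N c \<and> dist y (blinfun_apply f c) < d / 2"] N(2)[OF that, of c]
    unfolding p_def by blast+
  define h where "h f = restrict (p f) C" for f
  have "h ` B \<subseteq> PiE C N" using p(1) by (auto simp: h_def)
  then have fin: "finite (h ` B)"
    by (rule finite_subset) (simp add: finite_PiE \<open>finite C\<close> N(1))
  \<comment> \<open>One representative from \<open>B\<close> for each label that occurs.\<close>
  define F where "F = inv_into B h ` h ` B"
  show thesis
  proof (rule that[of F])
    show "finite F" using fin by (simp add: F_def)
    show "F \<subseteq> B" by (auto simp: F_def inv_into_into)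
    fix f assume f: "f \<in> B"
    define g where "g = inv_into B h (h f)"
    have g: "g \<in> B" "h g = h f" unfolding g_def using f by (auto simp: inv_into_into f_inv_into_f)
    have "norm (blinfun_apply g c - blinfun_apply f c) < d" if "c \<in> C" for c
    proof -
      have "p g c = p f c" using fun_cong[OF g(2), of c] that by (simp add: h_def)
      then show ?thesis
        using p(2)[OF g(1), of c] p(2)[OF f, of c]
          dist_triangle2[of "blinfun_apply g c" "blinfun_apply f c" "p f c"]
        by (simp add: dist_norm norm_minus_commute)
    qed
    then show "\<exists>g\<in>F. \<forall>c\<in>C. norm (blinfun_apply g c - blinfun_apply f c) < d"
      using f by (auto simp: F_def g_def)
  qed
qed

text \<open>Two members of \<open>B\<close> that nearly agree on a finite net of the image of the
  unit ball nearly agree on the whole image, so their adjoint images are close in norm.\<close>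

theorem schauder:
  fixes K :: "'a::banach \<Rightarrow>\<^sub>L 'a" and B :: "('a \<Rightarrow>\<^sub>L 'k::real_or_complex) set"
  assumes K: "precompact (blinfun_apply K ` cball 0 1)" and "bounded B"
  shows "precompact (adjoint_op K ` B)"
proof (rule precompactI)
  fix e :: real assume "e > 0"
  obtain M where "M > 0" and M: "\<And>f. f \<in> B \<Longrightarrow> norm f \<le> M"
    using \<open>bounded B\<close> by (auto simp: bounded_pos)
  \<comment> \<open>Since \<open>norm (g - f) \<le> 2 * M\<close>, this radius costs
    \<open>e / 4\<close>. The values on the net cost another \<open>e / 4\<close>, which leaves room
    for a strict bound by \<open>e\<close>.\<close>
  have "e / (8 * M) > 0" using \<open>e > 0\<close> \<open>M > 0\<close> by simp
  with K obtain C where C: "finite C"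
    "\<forall>x\<in>blinfun_apply K ` cball 0 1. \<exists>c\<in>C. dist c x < e / (8 * M)" by (rule precompactE)
  obtain F where F: "finite F" "F \<subseteq> B"
    "\<And>f. f \<in> B \<Longrightarrow> \<exists>g\<in>F. \<forall>c\<in>C. norm (blinfun_apply g c - blinfun_apply f c) < e / 4"
    using finite_net_bounded_functionals[OF \<open>bounded B\<close> C(1), of "e / 4"] \<open>e > 0\<close> by auto
  have "\<exists>g\<in>F. dist (adjoint_op K g) (adjoint_op K f) < e" if f: "f \<in> B" for f
  proof -
    obtain g where g: "g \<in> F" "\<And>c. c \<in> C \<Longrightarrow> norm (blinfun_apply g c - blinfun_apply f c) < e / 4"
      using F(3)[OF f] by blast
    have gf: "norm (g - f) \<le> 2 * M"
      using norm_triangle_ineq4[of g f] M[OF f] M[of g] g(1) F(2) by force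
    have small: "norm (blinfun_apply (adjoint_op K (g - f)) x) \<le> e / 2" if x: "norm x = 1" for x
    proof -
      have "blinfun_apply K x \<in> blinfun_apply K ` cball 0 1" using x by simp
      then obtain c where c: "c \<in> C" "dist c (blinfun_apply K x) < e / (8 * M)" using C(2) by blast
      have "norm (blinfun_apply (g - f) (blinfun_apply K x - c)) \<le> (2 * M) * (e / (8 * M))"
        by (rule order_trans[OF norm_blinfun mult_mono[OF gf]])
          (use c(2) \<open>M > 0\<close> in \<open>auto simp: dist_norm norm_minus_commute\<close>)
      also have "\<dots> = e / 4" using \<open>M > 0\<close> by simp
      finally have 1: "norm (blinfun_apply (g - f) (blinfun_apply K x - c)) \<le> e / 4" .
      have 2: "norm (blinfun_apply (g - f) c) < e / 4"
        using g(2)[OF c(1)] by (simp add: blinfun.diff_left)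
      have 3: "blinfun_apply (adjoint_op K (g - f)) x
          = blinfun_apply (g - f) (blinfun_apply K x - c) + blinfun_apply (g - f) c"
        by (simp add: blinfun.diff_right)
      show ?thesis
        unfolding 3
        using norm_triangle_ineq[of "blinfun_apply (g - f) (blinfun_apply K x - c)"
            "blinfun_apply (g - f) c"] 1 2 by linarith
    qed
    have "norm (adjoint_op K (g - f)) \<le> e / 2"
    proof (rule norm_blinfun_bound)
      fix x
      show "norm (blinfun_apply (adjoint_op K (g - f)) x) \<le> e / 2 * norm x"
      proof (cases "x = 0")
        case False
        have "norm (blinfun_apply (adjoint_op K (g - f)) (sgn x)) \<le> e / 2"
          by (rule small) (simp add: norm_sgn False)
        then show ?thesis
          using False by (simp add: sgn_div_norm blinfun.scaleR_right field_simps)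
      qed (simp add: blinfun.zero_right)
    qed (use \<open>e > 0\<close> in simp)
    moreover have "adjoint_op K (g - f) = adjoint_op K g - adjoint_op K f"
      by (simp add: bounded_linear.linear[OF bounded_linear_adjoint_op] linear_diff)
    ultimately have "dist (adjoint_op K g) (adjoint_op K f) < e"
      using \<open>e > 0\<close> by (simp add: dist_norm)
    then show ?thesis using g(1) by blast
  qed
  then show "\<exists>F. finite F \<and> (\<forall>x\<in>adjoint_op K ` B. \<exists>y\<in>F. dist y x < e)"
    using F(1) by (intro exI[of _ "adjoint_op K ` F"]) auto
qed

section \<open>Scalar perturbations\<close>

lemma bounded_linear_funpow:
  fixes f :: "'a::real_normed_vector \<Rightarrow> 'a"
  shows "bounded_linear f \<Longrightarrow> bounded_linear (f ^^ n)"
  by (induction n) (auto simp: id_def comp_def intro: bounded_linear_ident bounded_linear_compose)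

text \<open>Meant for \<open>P a\<close> saying that finitely many balls of radius \<open>a\<close>
  cover a sequence: if the radius can be contracted up to any error \<open>d\<close>, it can be made
  arbitrarily small.\<close>

lemma affine_contraction_descent:
  fixes c :: real
  assumes "0 \<le> c" "c < 1" "P e0" "e0 > 0" "e > 0"
    and mono: "\<And>a b. P a \<Longrightarrow> a \<le> b \<Longrightarrow> P b"
    and step: "\<And>a d. a > 0 \<Longrightarrow> d > 0 \<Longrightarrow> P a \<Longrightarrow> P (c * a + d)"
  shows "P e"
proof -
  \<comment> \<open>Chosen so that the map taking \<open>a\<close> to \<open>c * a + d\<close> has
    fixed point \<open>e / 2\<close>.\<close>
  define d where "d = e * (1 - c) / 2"
  have "d > 0" using assms by (simp add: d_def)
  have fixpoint: "c * (e / 2) + d = e / 2" by (simp add: d_def field_simps)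
  have "P (c ^ n * e0 + e / 2)" for n
  proof (induction n)
    case 0
    then show ?case using mono[OF \<open>P e0\<close>] \<open>e > 0\<close> by simp
  next
    case (Suc n)
    have "P (c * (c ^ n * e0 + e / 2) + d)"
      by (rule step) (use Suc assms \<open>d > 0\<close> in \<open>auto intro: add_nonneg_pos\<close>)
    also have "c * (c ^ n * e0 + e / 2) + d = c ^ Suc n * e0 + e / 2"
      using fixpoint by (simp add: distrib_left mult.assoc)
    finally show ?case .
  qed
  note P = this
  have "(\<lambda>n. c ^ n * e0) \<longlonglongrightarrow> 0"
    using assms by (intro tendsto_mult_left_zero LIMSEQ_power_zero) auto
  then have "\<forall>\<^sub>F n in sequentially. c ^ n * e0 < e / 2"
    using \<open>e > 0\<close> by (intro order_tendstoD) auto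
  then obtain n where "c ^ n * e0 < e / 2"
    by (auto simp: eventually_sequentially)
  then show ?thesis by (intro mono[OF P[of n]]) simp
qed

context banach_space_over
begin

lemma norm_scal_power: "norm (scal (c ^ n) x) = norm c ^ n * norm x"
  by (simp add: norm_scale norm_power)

text \<open>
  A shift leaves the optimal radius of a finite covering of the sequence unchanged, whereas
  multiplication by \<open>c\<close> changes it by the factor \<open>norm c \<noteq> 1\<close>, so this radius has to vanish.
\<close>

lemma precompact_range_of_recurrence:
  fixes u d :: "nat \<Rightarrow> 'a"
  assumes c: "norm c \<noteq> 1" and u: "bounded (range u)" and d: "precompact (range d)"
    and rec: "\<And>n. u (Suc n) = scal c (u n) + d n"
  shows "precompact (range u)"
proof -
  define P where "P e \<longleftrightarrow> (\<exists>F. finite F \<and> (\<forall>n. \<exists>y\<in>F. dist y (u n) < e))" for e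
  \<comment> \<open>For \<open>norm c > 1\<close> the recurrence is solved backwards, which
    contracts by the inverse factor.\<close>
  define q where "q = (if norm c < 1 then norm c else inverse (norm c))"
  have q: "0 \<le> q" "q < 1"
    using c by (auto simp: q_def inverse_less_1_iff)
  obtain M where M: "M > 0" "\<And>n. norm (u n) < M"
    using u by (auto simp: bounded_pos_less)
  have "P M" unfolding P_def
    by (rule exI[of _ "{0}"]) (use M in auto)
  have mono: "P b" if "P a" "a \<le> b" for a b
  proof -
    from \<open>P a\<close> obtain F where F: "finite F" "\<forall>n. \<exists>y\<in>F. dist y (u n) < a" unfolding P_def by blast
    have "\<exists>y\<in>F. dist y (u n) < b" for n
    proof -
      obtain y where "y \<in> F" "dist y (u n) < a" using F(2) by blast
      with \<open>a \<le> b\<close> show ?thesis by (intro bexI[of _ y]) auto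
    qed
    with F(1) show ?thesis unfolding P_def by blast
  qed
  have step: "P (q * a + t)" if at: "a > 0" "t > 0" "P a" for a t
  proof -
    obtain F where F: "finite F" "\<forall>n. \<exists>y\<in>F. dist y (u n) < a" using at(3) by (auto simp: P_def)
    obtain D where D: "finite D" "\<forall>x\<in>range d. \<exists>y\<in>D. dist y x < t"
      by (rule precompactE[OF d at(2)])
    show ?thesis
    proof (cases "norm c < 1")
      case True
      \<comment> \<open>The term \<open>u 0\<close> has no predecessor and serves as its own
        centre.\<close>
      let ?H = "insert (u 0) ((\<lambda>(f, g). scal c f + g) ` (F \<times> D))"
      have "\<exists>y\<in>?H. dist y (u n) < q * a + t" for n
      proof (cases n)
        case 0
        then show ?thesis using at q by (auto intro!: add_nonneg_pos)
      next
        case (Suc m)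
        obtain f where f: "f \<in> F" "dist f (u m) < a" using F(2) by blast
        obtain g where g: "g \<in> D" "dist g (d m) < t" using D(2) by blast
        have "dist (scal c f + g) (u n) \<le> dist (scal c f) (scal c (u m)) + dist g (d m)"
          unfolding Suc rec by (rule dist_triangle_add)
        also have "dist (scal c f) (scal c (u m)) = q * dist f (u m)"
          using True by (simp add: dist_norm q_def norm_scale flip: scale_right_diff_distrib)
        also have "q * dist f (u m) + dist g (d m) < q * a + t"
          using f g q by (intro add_le_less_mono mult_left_mono) auto
        finally show ?thesis using f(1) g(1) by force
      qed
      moreover have "finite ?H" using F(1) D(1) by simp
      ultimately show ?thesis unfolding P_def by blast
    next
      case False
      then have "norm c > 1" using c by simp
      then have "c \<noteq> 0" by auto
      let ?H = "(\<lambda>(f, g). scal (inverse c) (f - g)) ` (F \<times> D)"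
      have "\<exists>y\<in>?H. dist y (u n) < q * a + t" for n
      proof -
        obtain f where f: "f \<in> F" "dist f (u (Suc n)) < a" using F(2) by blast
        obtain g where g: "g \<in> D" "dist g (d n) < t" using D(2) by blast
        have "u n = scal (inverse c) (u (Suc n) - d n)"
          unfolding rec using \<open>c \<noteq> 0\<close> by simp
        then have "dist (scal (inverse c) (f - g)) (u n) = q * dist (f - g) (u (Suc n) - d n)"
          using False by (simp add: dist_norm q_def norm_scale norm_inverse flip: scale_right_diff_distrib)
        also have "\<dots> \<le> q * (dist f (u (Suc n)) + dist g (d n))"
          using q norm_triangle_ineq4[of "f - u (Suc n)" "g - d n"]
          by (intro mult_left_mono) (auto simp: dist_norm algebra_simps)
        also have "\<dots> \<le> q * dist f (u (Suc n)) + dist g (d n)"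
          using q by (simp add: distrib_left mult_left_le_one_le)
        also have "\<dots> < q * a + t"
          using f g q by (intro add_le_less_mono mult_left_mono) auto
        finally show ?thesis using f(1) g(1) by force
      qed
      moreover have "finite ?H" using F(1) D(1) by simp
      ultimately show ?thesis unfolding P_def by blast
    qed
  qed
  show ?thesis
  proof (rule precompactI)
    fix e :: real assume "e > 0"
    have "P e"
      by (rule affine_contraction_descent[OF q \<open>P M\<close> \<open>M > 0\<close> \<open>e > 0\<close> mono step])
    then show "\<exists>F. finite F \<and> (\<forall>x\<in>range u. \<exists>y\<in>F. dist y x < e)" by (simp add: P_def)
  qed
qed

lemma precompact_scalar_multiples:
  assumes "bounded C"
  shows "precompact ((\<lambda>c. scal c x) ` C)"
proof (rule precompactI)
  fix e :: real assume "e > 0"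
  have pre: "precompact C"
    using assms by (intro precompact_of_compact_closure) (simp add: compact_closure)
  \<comment> \<open>Adding 1 keeps the denominator positive when \<open>x = 0\<close>.\<close>
  have "e / (norm x + 1) > 0" using \<open>e > 0\<close> by (simp add: add_nonneg_pos)
  with pre obtain F where F: "finite F" "\<forall>c\<in>C. \<exists>b\<in>F. dist b c < e / (norm x + 1)"
    by (rule precompactE)
  have "\<exists>b\<in>F. dist (scal b x) (scal c x) < e" if "c \<in> C" for c
  proof -
    obtain b where b: "b \<in> F" "dist b c < e / (norm x + 1)" using F(2) \<open>c \<in> C\<close> by blast
    have "dist (scal b x) (scal c x) = dist b c * norm x"
      by (simp add: dist_norm norm_scale flip: scale_left_diff_distrib)
    also have "\<dots> \<le> dist b c * (norm x + 1)" by (intro mult_left_mono) auto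
    also have "\<dots> < e" using b(2) by (simp add: pos_less_divide_eq add_nonneg_pos)
    finally show ?thesis using b(1) by blast
  qed
  then show "\<exists>F. finite F \<and> (\<forall>y\<in>(\<lambda>c. scal c x) ` C. \<exists>z\<in>F. dist z y < e)"
    using F(1) by (intro exI[of _ "(\<lambda>b. scal b x) ` F"]) auto
qed

end

text \<open>
  \<open>V\<close> is the part of the type on which the operator is the scalar \<open>\<alpha>\<close> plus \<open>Q\<close>: everything for
  the operator itself, the scalar-linear functionals for its adjoint.
\<close>

locale scalar_perturbation = banach_space_over scal
  for scal :: "'k::real_or_complex \<Rightarrow> 'b::banach \<Rightarrow> 'b" +
  fixes V :: "'b set" and R Q :: "'b \<Rightarrow> 'b" and \<alpha> :: 'k and M :: real
  assumes V: "subspace V"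
    and R_V: "x \<in> V \<Longrightarrow> R x \<in> V" and Q_V: "x \<in> V \<Longrightarrow> Q x \<in> V"
    and R: "bounded_linear R" and Q: "bounded_linear Q"
    and Q_scal: "x \<in> V \<Longrightarrow> Q (scal c x) = scal c (Q x)"
    and R_eq: "x \<in> V \<Longrightarrow> R x = scal \<alpha> x + Q x"
    and M_pos: "M > 0" and R_bound: "norm ((R ^^ n) x) \<le> M * norm x"
begin

lemma R_power_V: "x \<in> V \<Longrightarrow> (R ^^ n) x \<in> V"
  by (induction n) (auto intro: R_V)

lemma Q_power_V: "x \<in> V \<Longrightarrow> (Q ^^ n) x \<in> V"
  by (induction n) (auto intro: Q_V)

lemmas R_linear = bounded_linear.linear[OF bounded_linear_funpow[OF R]]
lemmas Q_linear = bounded_linear.linear[OF bounded_linear_funpow[OF Q]]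

lemma Q_add: "Q (x + y) = Q x + Q y"
  by (rule linear_add[OF bounded_linear.linear[OF Q]])

lemma Q_R_commute: "x \<in> V \<Longrightarrow> Q (R x) = R (Q x)"
  by (simp add: R_eq Q_V Q_add Q_scal)

lemma R_scal: "x \<in> V \<Longrightarrow> R (scal c x) = scal c (R x)"
  by (simp add: R_eq subspace_scale[OF V] Q_scal scale_right_distrib scale_left_commute)

lemma Q_R_power_commute: "x \<in> V \<Longrightarrow> Q ((R ^^ n) x) = (R ^^ n) (Q x)"
  by (induction n) (auto simp: Q_R_commute R_power_V)

lemma Q_power_R_power_commute: "x \<in> V \<Longrightarrow> (Q ^^ j) ((R ^^ n) x) = (R ^^ n) ((Q ^^ j) x)"
  by (induction j) (auto simp: Q_R_power_commute Q_power_V)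

lemma bounded_orbit: "bounded (range (\<lambda>n. (R ^^ n) x))"
  using R_bound by (auto simp: bounded_iff)

section \<open>Orbits when \<open>norm \<alpha> \<noteq> 1\<close>\<close>

lemma precompact_orbit_norm_neq_1:
  assumes "norm \<alpha> \<noteq> 1" and x: "x \<in> V" and "\<And>B. bounded B \<Longrightarrow> precompact ((Q ^^ k) ` B)"
  shows "precompact (range (\<lambda>n. (R ^^ n) x))"
proof -
  \<comment> \<open>The index \<open>i\<close> counts the powers of \<open>Q\<close> already
    removed: the induction starts at \<open>Q ^^ k\<close> and ends at the orbit itself.\<close>
  have "precompact (range (\<lambda>n. (Q ^^ (k - i)) ((R ^^ n) x)))" if "i \<le> k" for i
    using that
  proof (induction i)
    case 0
    show ?case using assms(3)[OF bounded_orbit[of x]] by (simp add: image_image)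
  next
    case (Suc i)
    define j where "j = k - Suc i"
    have j: "k - i = Suc j" using Suc.prems by (simp add: j_def)
    have "precompact (range (\<lambda>n. (Q ^^ j) ((R ^^ n) x)))"
    proof (rule precompact_range_of_recurrence[OF assms(1)])
      show "bounded (range (\<lambda>n. (Q ^^ j) ((R ^^ n) x)))"
        using bounded_linear_image[OF bounded_orbit bounded_linear_funpow[OF Q]]
        by (simp add: image_image)
      show "precompact (range (\<lambda>n. (Q ^^ Suc j) ((R ^^ n) x)))"
        using Suc unfolding j by simp
      show "(Q ^^ j) ((R ^^ Suc n) x) = scal \<alpha> ((Q ^^ j) ((R ^^ n) x)) + (Q ^^ Suc j) ((R ^^ n) x)" for n
      proof -
        have "(Q ^^ j) ((R ^^ Suc n) x) = R ((Q ^^ j) ((R ^^ n) x))"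
          using Q_power_R_power_commute[OF R_power_V[OF x], of j 1 n] by simp
        then show ?thesis by (simp add: R_eq Q_power_V R_power_V x)
      qed
    qed
    then show ?case by (simp add: j_def)
  qed
  from this[of k] show ?thesis by simp
qed

section \<open>Kernel plus range of \<open>Q\<close>, and orbits, when
  \<open>norm \<alpha> = 1\<close>\<close>

text \<open>After rescaling by powers of \<open>\<alpha>\<close>, each increment of the orbit of
  \<open>y\<close>, plus \<open>u / \<alpha>\<close>, has norm at most
  \<open>M * norm (u + Q y)\<close>. Over n steps the increments telescope to a bounded quantity
  while the multiples of \<open>u\<close> grow like n, so dividing by n gives the bound.\<close>

lemma eigenvector_norm_bound:
  assumes \<alpha>: "norm \<alpha> = 1" and u: "u \<in> V" "Q u = 0" and y: "y \<in> V"
  shows "norm u \<le> M * norm (u + Q y)"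
proof -
  have "\<alpha> \<noteq> 0" using \<alpha> by auto
  define z where "z n = scal (inverse \<alpha> ^ n) ((R ^^ n) y)" for n
  define v where "v = scal (inverse \<alpha>) u"
  have Ru: "(R ^^ n) u = scal (\<alpha> ^ n) u" for n
    by (induction n) (auto simp: R_scal u R_eq)
  have step: "z (Suc n) - z n + v = scal (inverse \<alpha> ^ Suc n) ((R ^^ n) (u + Q y))" for n
  proof -
    have inv: "inverse \<alpha> ^ Suc n * \<alpha> ^ n = inverse \<alpha>" "inverse \<alpha> ^ Suc n * \<alpha> = inverse \<alpha> ^ n"
      using \<open>\<alpha> \<noteq> 0\<close> by (simp_all add: field_simps power_inverse)
    have "(R ^^ n) (u + Q y) = scal (\<alpha> ^ n) u + Q ((R ^^ n) y)"
      by (simp add: linear_add[OF R_linear] Ru Q_R_power_commute y)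
    also have "Q ((R ^^ n) y) = (R ^^ Suc n) y - scal \<alpha> ((R ^^ n) y)"
      by (simp add: R_eq R_power_V y)
    finally have "(R ^^ n) (u + Q y) = scal (\<alpha> ^ n) u + ((R ^^ Suc n) y - scal \<alpha> ((R ^^ n) y))" .
    then show ?thesis
      by (simp only: z_def v_def scale_right_distrib scale_right_diff_distrib scale_scale inv add.commute)
  qed
  have z: "norm (z n - z 0 + real n *\<^sub>R v) \<le> real n * (M * norm (u + Q y))" for n
  proof (induction n)
    case (Suc n)
    have "norm (z (Suc n) - z n + v) \<le> M * norm (u + Q y)"
      unfolding step norm_scal_power using R_bound[of n "u + Q y"] by (simp add: norm_inverse \<alpha>)
    moreover have eq: "z (Suc n) - z 0 + real (Suc n) *\<^sub>R v
        = (z n - z 0 + real n *\<^sub>R v) + (z (Suc n) - z n + v)"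
      by (simp add: algebra_simps)
    have "real (Suc n) * (M * norm (u + Q y)) = real n * (M * norm (u + Q y)) + M * norm (u + Q y)"
      by (simp add: distrib_right)
    ultimately show ?case
      unfolding eq
      using norm_triangle_ineq[of "z n - z 0 + real n *\<^sub>R v" "z (Suc n) - z n + v"] Suc
      by linarith
  qed simp
  have "real n * norm u \<le> real n * (M * norm (u + Q y)) + 2 * (M * norm y)" for n
  proof -
    have zn: "norm (z m) \<le> M * norm y" for m
      unfolding z_def norm_scal_power using R_bound[of m y] by (simp add: norm_inverse \<alpha>)
    have "real n * norm u = norm (real n *\<^sub>R v)"
      by (simp add: v_def norm_scale norm_inverse \<alpha>)
    also have "real n *\<^sub>R v = (z n - z 0 + real n *\<^sub>R v) - (z n - z 0)" by simp
    also have "norm \<dots> \<le> norm (z n - z 0 + real n *\<^sub>R v) + norm (z n - z 0)"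
      by (rule norm_triangle_ineq4)
    also have "norm (z n - z 0) \<le> norm (z n) + norm (z 0)"
      by (rule norm_triangle_ineq4)
    finally show ?thesis using z[of n] zn[of n] zn[of 0] by linarith
  qed
  note growth = this
  show ?thesis
  proof (rule ccontr)
    assume "\<not> ?thesis"
    \<comment> \<open>If the bound failed, the linear growth would overtake the bounded boundary
      terms.\<close>
    then obtain n where "2 * (M * norm y) < real n * (norm u - M * norm (u + Q y))"
      using ex_less_of_nat_mult[of "norm u - M * norm (u + Q y)"] by auto
    then show False using growth[of n] by (simp add: algebra_simps)
  qed
qed

text \<open>Sending \<open>u + Q y\<close> to \<open>\<psi> u\<close> is well defined and bounded by
  \<open>C * M\<close>, because \<open>norm u \<le> M * norm (u + Q y)\<close>; Hahn--Banach extends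
  it. As \<open>\<psi>\<close> is a plain function controlled on \<open>V\<close> alone, it may be a
  functional or, on the dual, evaluation at a vector.\<close>

lemma functional_matching_eigenvectors:
  fixes \<psi> :: "'b \<Rightarrow> 'k"
  assumes \<alpha>: "norm \<alpha> = 1"
    and \<psi>: "\<And>x y. x \<in> V \<Longrightarrow> y \<in> V \<Longrightarrow> \<psi> (x + y) = \<psi> x + \<psi> y"
      "\<And>c x. x \<in> V \<Longrightarrow> \<psi> (scal c x) = c * \<psi> x" "\<And>x. x \<in> V \<Longrightarrow> norm (\<psi> x) \<le> C * norm x"
    and "C \<ge> 0"
  obtains F where "F \<in> dual scal" "\<And>u. u \<in> V \<Longrightarrow> Q u = 0 \<Longrightarrow> blinfun_apply F u = \<psi> u"
    "\<And>y. y \<in> V \<Longrightarrow> blinfun_apply F (Q y) = 0"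
proof -
  define G where "G = {(u + Q y, \<psi> u) | u y. u \<in> V \<and> Q u = 0 \<and> y \<in> V}"
  have GI: "(u + Q y, \<psi> u) \<in> G" if "u \<in> V" "Q u = 0" "y \<in> V" for u y
    using that by (auto simp: G_def)
  have GE: thesis if "(x, r) \<in> G"
    "\<And>u y. x = u + Q y \<Longrightarrow> r = \<psi> u \<Longrightarrow> u \<in> V \<Longrightarrow> Q u = 0 \<Longrightarrow> y \<in> V \<Longrightarrow> thesis" for x r thesis
    using that by (auto simp: G_def)
  have V0: "0 \<in> V" by (rule subspace_0[OF V])
  have Q0: "Q 0 = 0" by (rule linear_0[OF bounded_linear.linear[OF Q]])
  have \<psi>0: "\<psi> 0 = 0" using \<psi>(2)[OF V0, of 0] by simp
  show thesis
  proof (rule hahn_banach[of G "C * M"])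
    show "(0, 0) \<in> G" using GI[OF V0 Q0 V0] by (simp add: Q0 \<psi>0)
    show "(x + x', r + r') \<in> G" if "(x, r) \<in> G" "(x', r') \<in> G" for x r x' r'
    proof (rule GE[OF that(1)], rule GE[OF that(2)])
      fix u y u' y'
      assume "x = u + Q y" "r = \<psi> u" "x' = u' + Q y'" "r' = \<psi> u'" and
        uy: "u \<in> V" "Q u = 0" "y \<in> V" "u' \<in> V" "Q u' = 0" "y' \<in> V"
      then show ?thesis
        using GI[of "u + u'" "y + y'"] by (simp add: Q_add subspace_add[OF V] \<psi> algebra_simps)
    qed
    show "(scal c x, c * r) \<in> G" if "(x, r) \<in> G" for c x r
    proof (rule GE[OF that])
      fix u y
      assume "x = u + Q y" "r = \<psi> u" "u \<in> V" "Q u = 0" "y \<in> V"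
      then show ?thesis
        using GI[of "scal c u" "scal c y"]
        by (simp add: Q_scal subspace_scale[OF V] \<psi> scale_right_distrib)
    qed
    show "norm r \<le> C * M * norm x" if "(x, r) \<in> G" for x r
    proof (rule GE[OF that])
      fix u y
      assume uy: "x = u + Q y" "r = \<psi> u" "u \<in> V" "Q u = 0" "y \<in> V"
      then have "norm r \<le> C * norm u" using \<psi>(3) by simp
      also have "\<dots> \<le> C * (M * norm x)"
        using eigenvector_norm_bound[OF \<alpha> uy(3-5)] \<open>C \<ge> 0\<close> uy(1) by (intro mult_left_mono) auto
      finally show ?thesis by (simp add: mult.assoc)
    qed
    show "C * M \<ge> 0" using \<open>C \<ge> 0\<close> M_pos by simp
  next
    fix F assume F: "F \<in> dual scal" "\<And>x r. (x, r) \<in> G \<Longrightarrow> blinfun_apply F x = r"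
    show thesis
    proof (rule that[OF F(1)])
      show "blinfun_apply F u = \<psi> u" if "u \<in> V" "Q u = 0" for u
        using F(2)[OF GI[OF that V0]] by (simp add: Q0)
      show "blinfun_apply F (Q y) = 0" if "y \<in> V" for y
        using F(2)[OF GI[OF V0 Q0 that]] by (simp add: \<psi>0)
    qed
  qed
qed

text \<open>For nonzero \<open>\<alpha>\<close> this is the space of the mean ergodic theorem for
  \<open>R / \<alpha>\<close> on \<open>V\<close>: the fixed vectors plus the range of the identity
  minus that operator.\<close>

definition ergodic_sum :: "'b set" where
  "ergodic_sum = {u + Q y | u y. u \<in> V \<and> Q u = 0 \<and> y \<in> V}"

lemma ergodic_sumI: "u \<in> V \<Longrightarrow> Q u = 0 \<Longrightarrow> y \<in> V \<Longrightarrow> u + Q y \<in> ergodic_sum"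
  by (auto simp: ergodic_sum_def)

lemma ergodic_sum_eigenvector: "u \<in> V \<Longrightarrow> Q u = 0 \<Longrightarrow> u \<in> ergodic_sum"
  using ergodic_sumI[of u 0] subspace_0[OF V] linear_0[OF bounded_linear.linear[OF Q]] by simp

lemma ergodic_sum_range: "y \<in> V \<Longrightarrow> Q y \<in> ergodic_sum"
  using ergodic_sumI[of 0 y] subspace_0[OF V] linear_0[OF bounded_linear.linear[OF Q]] by simp

lemma subspace_ergodic_sum: "subspace ergodic_sum"
proof (rule subspaceI)
  show "0 \<in> ergodic_sum"
    using ergodic_sum_eigenvector[of 0] subspace_0[OF V] linear_0[OF bounded_linear.linear[OF Q]] by simp
  show "x + y \<in> ergodic_sum" if "x \<in> ergodic_sum" "y \<in> ergodic_sum" for x y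
  proof -
    from that obtain u v w z where "x = u + Q v" "y = w + Q z" and V': "u \<in> V" "v \<in> V" "w \<in> V" "z \<in> V"
      and "Q u = 0" "Q w = 0" by (auto simp: ergodic_sum_def)
    then show ?thesis
      using ergodic_sumI[of "u + w" "v + z"] by (simp add: Q_add subspace_add[OF V] algebra_simps)
  qed
  show "scal c x \<in> ergodic_sum" if "x \<in> ergodic_sum" for c x
  proof -
    from that obtain u v where "x = u + Q v" "u \<in> V" "v \<in> V" "Q u = 0"
      by (auto simp: ergodic_sum_def)
    then show ?thesis
      using ergodic_sumI[of "scal c u" "scal c v"]
      by (simp add: Q_scal subspace_scale[OF V] scale_right_distrib)
  qed
qed

text \<open>
  Splitting \<open>y\<close> in \<open>x = u + Q y\<close> again shows that the range of \<open>Q\<close> may be replaced by that of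
  any power of \<open>Q\<close>.
\<close>

lemma approx_eigenvector_plus_power_range:
  assumes dense: "V \<subseteq> closure ergodic_sum" and "x \<in> V" "e > 0"
  shows "\<exists>u\<in>V. \<exists>y\<in>V. Q u = 0 \<and> dist (u + (Q ^^ j) y) x < e"
  using \<open>e > 0\<close>
proof (induction j arbitrary: e)
  case 0
  show ?case
    using subspace_0[OF V] \<open>x \<in> V\<close> linear_0[OF bounded_linear.linear[OF Q]] 0
    by (intro bexI[of _ 0] bexI[of _ x]) auto
next
  case (Suc j)
  obtain u y where uy: "u \<in> V" "y \<in> V" "Q u = 0" "dist (u + (Q ^^ j) y) x < e / 2"
    using Suc.IH[of "e / 2"] Suc.prems by auto
  obtain L where "L > 0" and L: "\<And>z. norm ((Q ^^ j) z) \<le> norm z * L"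
    using bounded_linear.pos_bounded[OF bounded_linear_funpow[OF Q, of j]] by blast
  have "e / (2 * L) > 0" using Suc.prems \<open>L > 0\<close> by simp
  moreover have "y \<in> closure ergodic_sum" using dense uy(2) by blast
  ultimately obtain w where "w \<in> ergodic_sum" "dist w y < e / (2 * L)"
    by (meson closure_approachable)
  then obtain v z where vz: "v \<in> V" "z \<in> V" "Q v = 0" "dist (v + Q z) y < e / (2 * L)"
    by (auto simp: ergodic_sum_def)
  \<comment> \<open>Replacing \<open>y\<close> by \<open>v + Q z\<close> turns
    \<open>(Q ^^ j) y\<close> into \<open>(Q ^^ j) v + (Q ^^ Suc j) z\<close>, and the first summand
    lies in the kernel of \<open>Q\<close>, so it joins \<open>u\<close>. The error grows at most by
    the factor \<open>L\<close>.\<close>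
  define u' where "u' = u + (Q ^^ j) v"
  have "Q ((Q ^^ j) v) = (Q ^^ j) (Q v)" by (simp add: funpow_swap1)
  then have u': "u' \<in> V" "Q u' = 0"
    using uy vz Q_power_V[of v j] linear_0[OF Q_linear]
    by (auto simp: u'_def Q_add subspace_add[OF V])
  have "u' + (Q ^^ Suc j) z = u + (Q ^^ j) (v + Q z)"
    by (simp add: u'_def linear_add[OF Q_linear] funpow_swap1 add.assoc)
  then have "dist (u' + (Q ^^ Suc j) z) (u + (Q ^^ j) y) = norm ((Q ^^ j) (v + Q z - y))"
    by (simp add: dist_norm linear_diff[OF Q_linear])
  also have "\<dots> \<le> dist (v + Q z) y * L"
    using L[of "v + Q z - y"] by (simp add: dist_norm)
  also have "\<dots> < e / 2"
    using vz(4) \<open>L > 0\<close> by (simp add: field_simps)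
  finally have "dist (u' + (Q ^^ Suc j) z) x < e"
    using uy(4) dist_triangle[of "u' + (Q ^^ Suc j) z" x "u + (Q ^^ j) y"] by linarith
  then show ?case using u' vz(2) by blast
qed

lemma precompact_orbit_norm_eq_1:
  assumes \<alpha>: "norm \<alpha> = 1" and dense: "V \<subseteq> closure ergodic_sum" and x: "x \<in> V"
    and compact: "\<And>B. bounded B \<Longrightarrow> precompact ((Q ^^ k) ` B)"
  shows "precompact (range (\<lambda>n. (R ^^ n) x))"
proof (rule precompact_approx)
  fix e :: real assume "e > 0"
  \<comment> \<open>Powers of \<open>R\<close> enlarge distances by at most \<open>M\<close>, so
    this accuracy serves all n at once.\<close>
  then have "e / M > 0" using M_pos by simp
  then obtain u y where uy: "u \<in> V" "y \<in> V" "Q u = 0" "dist (u + (Q ^^ k) y) x < e / M"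
    using approx_eigenvector_plus_power_range[OF dense x] by blast
  \<comment> \<open>Holds the whole orbit of \<open>u + (Q ^^ k) y\<close>: its first part is
    \<open>\<alpha> ^ n\<close> times \<open>u\<close>, its second \<open>Q ^^ k\<close> applied to
    the orbit of \<open>y\<close>.\<close>
  define B where "B = {a + b | a b. a \<in> (\<lambda>c. scal c u) ` cball 0 1
    \<and> b \<in> (Q ^^ k) ` range (\<lambda>n. (R ^^ n) y)}"
  have "precompact B"
    unfolding B_def
    by (intro precompact_sums precompact_scalar_multiples compact bounded_orbit bounded_cball)
  moreover have "\<exists>b\<in>B. dist b ((R ^^ n) x) < e" for n
  proof
    have "(R ^^ n) u = scal (\<alpha> ^ n) u"
      by (induction n) (auto simp: R_scal uy R_eq)
    then have eq: "(R ^^ n) (u + (Q ^^ k) y) = scal (\<alpha> ^ n) u + (Q ^^ k) ((R ^^ n) y)"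
      by (simp add: linear_add[OF R_linear] Q_power_R_power_commute uy)
    have "norm (\<alpha> ^ n) \<le> 1" by (simp add: norm_power \<alpha>)
    then show "(R ^^ n) (u + (Q ^^ k) y) \<in> B"
      unfolding eq B_def
      by (intro CollectI exI conjI refl image_eqI[where x = "\<alpha> ^ n"] imageI rangeI) auto
    have "dist ((R ^^ n) (u + (Q ^^ k) y)) ((R ^^ n) x) \<le> M * dist (u + (Q ^^ k) y) x"
      using R_bound[of n "u + (Q ^^ k) y - x"] by (simp add: dist_norm linear_diff[OF R_linear])
    also have "\<dots> < e"
      using uy(4) M_pos by (simp add: field_simps)
    finally show "dist ((R ^^ n) (u + (Q ^^ k) y)) ((R ^^ n) x) < e" .
  qed
  ultimately show "\<exists>B. precompact B \<and> (\<forall>z\<in>range (\<lambda>n. (R ^^ n) x). \<exists>b\<in>B. dist b z < e)"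
    by blast
qed

theorem almost_periodic:
  assumes "norm \<alpha> = 1 \<Longrightarrow> V \<subseteq> closure ergodic_sum"
    and "\<And>B. bounded B \<Longrightarrow> precompact ((Q ^^ k) ` B)"
  shows "almost_periodic_on V R"
  unfolding almost_periodic_on_def
proof
  fix x assume x: "x \<in> V"
  have "precompact (range (\<lambda>n. (R ^^ n) x))"
  proof (cases "norm \<alpha> = 1")
    case True
    show ?thesis by (rule precompact_orbit_norm_eq_1[OF True assms(1)[OF True] x assms(2)])
  next
    case False
    then show ?thesis by (rule precompact_orbit_norm_neq_1[OF _ x assms(2)])
  qed
  then show "compact (closure (range (\<lambda>n. (R ^^ n) x)))"
    by (rule compact_closure_of_precompact)
qed

end

section \<open>The dual space and reflexivity\<close>

lemma banach_space_over_dual_scale: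
  "banach_space_over (dual_scale :: 'k::real_or_complex \<Rightarrow> ('a::banach \<Rightarrow>\<^sub>L 'k) \<Rightarrow> _)"
proof
  fix c d :: 'k and f g :: "'a \<Rightarrow>\<^sub>L 'k" and r :: real
  show "dual_scale c (f + g) = dual_scale c f + dual_scale c g"
    by (rule blinfun_eqI) (simp add: blinfun.add_left distrib_left)
  show "dual_scale (c + d) f = dual_scale c f + dual_scale d f"
    by (rule blinfun_eqI) (simp add: blinfun.add_left distrib_right)
  show "dual_scale c (dual_scale d f) = dual_scale (c * d) f"
    by (rule blinfun_eqI) (simp add: mult.assoc)
  show "dual_scale 1 f = f"
    by (rule blinfun_eqI) simp
  show "dual_scale (of_real r) f = r *\<^sub>R f"
    by (rule blinfun_eqI) (simp add: blinfun.scaleR_left scaleR_conv_of_real)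
  have le: "norm (dual_scale a h) \<le> norm a * norm h" for a and h :: "'a \<Rightarrow>\<^sub>L 'k"
  proof (rule norm_blinfun_bound)
    show "norm (blinfun_apply (dual_scale a h) x) \<le> norm a * norm h * norm x" for x
      using norm_blinfun[of h x] by (simp add: norm_mult mult.assoc mult_left_mono)
  qed simp
  show "norm (dual_scale c f) = norm c * norm f"
  proof (cases "c = 0")
    case True
    then show ?thesis using le[of 0 f] by simp
  next
    case False
    \<comment> \<open>The reverse inequality is \<open>le\<close> applied to the inverse
      scalar.\<close>
    have "dual_scale (inverse c) (dual_scale c f) = f"
      by (rule blinfun_eqI) (simp add: False flip: mult.assoc)
    then have "norm c * norm f \<le> norm (dual_scale c f)"
      using le[of "inverse c" "dual_scale c f"] False
      by (simp add: norm_divide norm_inverse inverse_eq_divide pos_le_divide_eq mult.commute)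
    then show ?thesis using le[of c f] by simp
  qed
qed

text \<open>A member of \<open>dual dual_scale\<close> is defined on all bounded real-linear maps
  into the scalars. It still satisfies the conditions of \<open>bidual scal\<close>, so it is an
  evaluation on the actual dual.\<close>

lemma reflexive_evaluation:
  assumes "reflexive scal" "\<Phi> \<in> dual dual_scale"
  obtains x where "\<And>f. f \<in> dual scal \<Longrightarrow> blinfun_apply \<Phi> f = blinfun_apply f x"
proof -
  have "blinfun_apply \<Phi> \<in> bidual scal"
    using assms(2) unfolding bidual_def dual_def
    by (auto simp: blinfun.add_right intro: norm_blinfun)
  then show thesis using assms(1) that unfolding reflexive_def by blast
qed

section \<open>Density of kernel plus range in the space and in its dual\<close>

locale reflexive_perturbation =
  X: scalar_perturbation scal UNIV "blinfun_apply T" "blinfun_apply S" \<alpha> M +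
  Y: scalar_perturbation dual_scale "dual scal" "adjoint_op T" "adjoint_op S" \<alpha> M
  for scal :: "'k::real_or_complex \<Rightarrow> 'a::banach \<Rightarrow> 'a" and T S \<alpha> M +
  assumes reflexive: "reflexive scal" and norm_\<alpha>: "norm \<alpha> = 1"
begin

lemma kernel_of_annihilated:
  assumes "\<And>h. h \<in> dual scal \<Longrightarrow> blinfun_apply h (blinfun_apply S y) = 0"
  shows "blinfun_apply S y = 0"
  using X.dual_separates_points assms by blast

text \<open>A functional \<open>f\<close> separating \<open>x\<close> from the sum lies in the
  kernel of the adjoint of \<open>S\<close>. Take \<open>\<Phi>\<close> equal to evaluation at
  \<open>x\<close> on that kernel and zero on the range of the adjoint. By reflexivity it is
  evaluation at some \<open>y\<close>; then \<open>S y = 0\<close>, so \<open>f y = 0\<close>, yet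
  \<open>f y = f x \<noteq> 0\<close>.\<close>

theorem dense_ergodic_sum: "UNIV \<subseteq> closure X.ergodic_sum"
proof
  fix x
  show "x \<in> closure X.ergodic_sum"
  proof (rule ccontr)
    assume "x \<notin> closure X.ergodic_sum"
    then obtain f where f: "f \<in> dual scal" "\<And>w. w \<in> X.ergodic_sum \<Longrightarrow> blinfun_apply f w = 0"
      "blinfun_apply f x \<noteq> 0"
      by (rule X.hahn_banach_separation[OF X.subspace_ergodic_sum]) (rule that; simp)
    have Sf: "adjoint_op S f = 0"
      by (rule blinfun_eqI) (simp add: f(2) X.ergodic_sum_range)
    obtain \<Phi> where \<Phi>: "\<Phi> \<in> dual dual_scale"
      "\<And>g. g \<in> dual scal \<Longrightarrow> adjoint_op S g = 0 \<Longrightarrow> blinfun_apply \<Phi> g = blinfun_apply g x"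
      "\<And>g. g \<in> dual scal \<Longrightarrow> blinfun_apply \<Phi> (adjoint_op S g) = 0"
    proof (rule Y.functional_matching_eigenvectors[OF norm_\<alpha>, of "\<lambda>g. blinfun_apply g x" "norm x"])
      show "norm (blinfun_apply g x) \<le> norm x * norm g" for g :: "'a \<Rightarrow>\<^sub>L 'k"
        using norm_blinfun[of g x] by (simp add: mult.commute)
    qed (simp_all add: blinfun.add_left)
    obtain y where y: "\<And>h. h \<in> dual scal \<Longrightarrow> blinfun_apply \<Phi> h = blinfun_apply h y"
      using reflexive_evaluation[OF reflexive \<Phi>(1)] by blast
    have "blinfun_apply S y = 0"
      by (rule kernel_of_annihilated) (use y[OF Y.Q_V] \<Phi>(3) in simp)
    then have "blinfun_apply f y = 0"
      by (intro f(2) X.ergodic_sum_eigenvector) simp_all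
    then show False
      using y[OF f(1)] \<Phi>(2)[OF f(1) Sf] f(3) by simp
  qed
qed

text \<open>The roles are exchanged. A separating \<open>\<Phi>\<close> is evaluation at some
  \<open>y\<close> with \<open>S y = 0\<close>. Take \<open>g\<close> equal to \<open>f\<close> on
  the kernel of \<open>S\<close> and zero on its range; it lies in the kernel of the adjoint, so
  \<open>\<Phi> g = 0\<close>, yet \<open>\<Phi> g = g y = f y = \<Phi> f\<close>.\<close>

theorem dual_dense_ergodic_sum: "dual scal \<subseteq> closure Y.ergodic_sum"
proof
  fix f assume f: "f \<in> dual scal"
  show "f \<in> closure Y.ergodic_sum"
  proof (rule ccontr)
    assume "f \<notin> closure Y.ergodic_sum"
    then obtain \<Phi> where \<Phi>: "\<Phi> \<in> dual dual_scale"
      "\<And>g. g \<in> Y.ergodic_sum \<Longrightarrow> blinfun_apply \<Phi> g = 0" "blinfun_apply \<Phi> f \<noteq> 0"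
      by (rule Y.hahn_banach_separation[OF Y.subspace_ergodic_sum]) (rule that; simp)
    obtain y where y: "\<And>h. h \<in> dual scal \<Longrightarrow> blinfun_apply \<Phi> h = blinfun_apply h y"
      using reflexive_evaluation[OF reflexive \<Phi>(1)] by blast
    have Sy: "blinfun_apply S y = 0"
      by (rule kernel_of_annihilated) (use y[OF Y.Q_V] \<Phi>(2)[OF Y.ergodic_sum_range] in simp)
    obtain g where g: "g \<in> dual scal"
      "\<And>u. blinfun_apply S u = 0 \<Longrightarrow> blinfun_apply g u = blinfun_apply f u"
      "\<And>u. blinfun_apply g (blinfun_apply S u) = 0"
    proof (rule X.functional_matching_eigenvectors[OF norm_\<alpha>, of "blinfun_apply f" "norm f"])
      show "blinfun_apply f (scal c x) = c * blinfun_apply f x" for c x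
        using f by (simp add: dual_def)
    qed (simp_all add: blinfun.add_right norm_blinfun)
    have "adjoint_op S g = 0"
      by (rule blinfun_eqI) (simp add: g(3))
    then have "blinfun_apply \<Phi> g = 0"
      by (intro \<Phi>(2) Y.ergodic_sum_eigenvector g(1))
    then show False
      using y[OF g(1)] y[OF f] g(2)[OF Sy] \<Phi>(3) by simp
  qed
qed

end

section \<open>Almost periodicity of the operator and of its adjoint\<close>

theorem theorem2p8:
  fixes scal :: "'k::real_or_complex \<Rightarrow> 'a::banach \<Rightarrow> 'a"
    and T S :: "'a \<Rightarrow>\<^sub>L 'a"
    and \<alpha> :: 'k
    and k :: nat
  assumes "banach_space_over scal"
    and "reflexive scal"
    and "scalar_linear scal T"
    and "power_bounded T"
    and "scalar_linear scal S"
    and "\<And>x. T x = scal \<alpha> x + S x"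
    and "k \<ge> 1"
    and "compact_operator (blinfun_apply S ^^ k)"
  shows "almost_periodic_on UNIV (blinfun_apply T)
    \<and> almost_periodic_on (dual scal) (adjoint_op T)"
proof -
  interpret B: banach_space_over scal by fact
  interpret D: banach_space_over "dual_scale :: 'k \<Rightarrow> ('a \<Rightarrow>\<^sub>L 'k) \<Rightarrow> _"
    by (rule banach_space_over_dual_scale)
  have blinfun_power: "bounded_linear (blinfun_apply A ^^ n)" for A :: "'a \<Rightarrow>\<^sub>L 'a" and n
    by (rule bounded_linear_funpow[OF blinfun.bounded_linear_right])
  obtain M0 where M0: "\<And>n. onorm (blinfun_apply T ^^ n) \<le> M0"
    using \<open>power_bounded T\<close> by (auto simp: power_bounded_def bdd_above_def)
  \<comment> \<open>The maximum with 1 makes the constant positive, also on the trivial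
    space.\<close>
  define M where "M = max M0 1"
  have "M > 0" by (simp add: M_def)
  have T_bound: "norm ((blinfun_apply T ^^ n) x) \<le> M * norm x" for n x
  proof -
    have "onorm (blinfun_apply T ^^ n) \<le> M" using M0[of n] by (simp add: M_def)
    then show ?thesis
      by (rule order_trans[OF onorm[OF blinfun_power] mult_right_mono]) simp
  qed
  interpret X: scalar_perturbation scal UNIV "blinfun_apply T" "blinfun_apply S" \<alpha> M
  proof (intro scalar_perturbation.intro scalar_perturbation_axioms.intro \<open>banach_space_over scal\<close>)
    show "blinfun_apply S (scal c x) = scal c (blinfun_apply S x)" for c x
      using assms(5) by (simp add: scalar_linear_def)
  qed (simp_all add: \<open>M > 0\<close> T_bound assms(6)[symmetric] blinfun.bounded_linear_right)
  \<comment> \<open>This is the Banach space adjoint, linear in the scalars, so the same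
    \<open>\<alpha>\<close> appears without conjugation.\<close>
  interpret Y: scalar_perturbation dual_scale "dual scal" "adjoint_op T" "adjoint_op S" \<alpha> M
  proof (intro scalar_perturbation.intro scalar_perturbation_axioms.intro banach_space_over_dual_scale)
    show "D.subspace (dual scal)"
      by (rule D.subspaceI) (simp_all add: dual_scale_in_dual add_in_dual, simp add: dual_def)
    show "adjoint_op T f \<in> dual scal" "adjoint_op S f \<in> dual scal" if "f \<in> dual scal" for f
      using that adjoint_op_in_dual assms(3,5) by blast+
    show "adjoint_op S (dual_scale c f) = dual_scale c (adjoint_op S f)" for c f
      by (rule blinfun_eqI) simp
    show "adjoint_op T f = dual_scale \<alpha> f + adjoint_op S f" if "f \<in> dual scal" for f
      using that by (intro blinfun_eqI) (simp add: dual_def assms(6) blinfun.add_left blinfun.add_right)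
    show "norm ((adjoint_op T ^^ n) f) \<le> M * norm f" for n f
    proof (rule norm_blinfun_bound)
      fix x
      have "norm (blinfun_apply f ((blinfun_apply T ^^ n) x)) \<le> norm f * (M * norm x)"
        by (rule order_trans[OF norm_blinfun mult_left_mono[OF T_bound]]) simp
      then show "norm (blinfun_apply ((adjoint_op T ^^ n) f) x) \<le> M * norm f * norm x"
        by (simp add: adjoint_op_power_apply mult_ac)
    qed (use \<open>M > 0\<close> in simp)
  qed (use \<open>M > 0\<close> in \<open>auto intro: bounded_linear_adjoint_op\<close>)
  have "reflexive_perturbation scal T S \<alpha> M" if "norm \<alpha> = 1"
    by (intro reflexive_perturbation.intro reflexive_perturbation_axioms.intro
        X.scalar_perturbation_axioms Y.scalar_perturbation_axioms that assms(2))
  note dense = reflexive_perturbation.dense_ergodic_sum[OF this]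
    reflexive_perturbation.dual_dense_ergodic_sum[OF this]
  have S_compact: "precompact ((blinfun_apply S ^^ k) ` B)" if "bounded B" for B
    using assms(8) that precompact_of_compact_closure unfolding compact_operator_def by blast
  \<comment> \<open>Packing the power of \<open>S\<close> as one bounded operator makes Schauder's
    theorem applicable, since the adjoint of the power is the power of the adjoint.\<close>
  define K where "K = Blinfun (blinfun_apply S ^^ k)"
  have K: "blinfun_apply K = blinfun_apply S ^^ k"
    unfolding K_def by (rule bounded_linear_Blinfun_apply[OF blinfun_power])
  have adjoint_K: "adjoint_op S ^^ k = (adjoint_op K :: ('a \<Rightarrow>\<^sub>L 'k) \<Rightarrow> _)"
    by (intro ext blinfun_eqI) (simp add: adjoint_op_power_apply K)
  have adjoint_compact: "precompact ((adjoint_op S ^^ k) ` B)" if "bounded B" for B :: "('a \<Rightarrow>\<^sub>L 'k) set"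
    unfolding adjoint_K by (rule schauder) (simp_all add: K S_compact that)
  show ?thesis
    using X.almost_periodic[OF dense(1) S_compact] Y.almost_periodic[OF dense(2) adjoint_compact]
    by blast
qed

end
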